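(* Let $X$ be a finite-dimensional inner product space over $\mathbb{R}$ (real case) or over $\mathbb{C}$ with Hermitian product (complex case). Let $V\subset X$ be a subspace and $p=\dim V$. For any Lebesgue measurable set $S\subset V$, \begin{itemize} \item in the real case, $|S|_p^2 = \sum_I |S_I|_p^2$; \item in the complex case, $|S|_{2p} = \sum_I |S_I|_{2p}$; \end{itemize} where the sums run over the orthogonal projections $S_I$ of $S$ on all $p$-dimensional coordinate subspaces $V_I$ of an orthogonal basis of $X$.
   Context: Subspaces, dimension, bases and orthogonality are taken over the same field as $X$. Let $n=\dim X$. For a basis $(v_1,\ldots,v_n)$ of $X$, $1\le q\le n$, and a multi-index $I=(i_1,\ldots,i_q)$ with $1\le i_1<\cdots<i_q\le n$, let $V_I=\operatorname{span}(v_{i_1},\ldots,v_{i_q})$; these $\binom{n}{q}$ subspaces are the $q$-dimensional coordinate subspaces of the basis. A complex space is also regarded as a real inner product space with inner product $\operatorname{Re}\langle\cdot,\cdot\rangle$. On any real or complex subspace $U\subset X$, $|\cdot|_m$ denotes the $m$-dimensional Lebesgue measure of $U$ if $m=\dim_{\mathbb{R}} U$, and $|\cdot|_m=0$ if $m>\dim_{\mathbb{R}}U$. The measure of a projected set $S_I$ is taken in the subspace which is the orthogonal projection of $V$ on $V_I$. *)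

theory Defs
  imports "HOL-Analysis.Analysis"
begin

text \<open>
  Complex inner product spaces. The real structure of the underlying \<^class>\<open>real_inner\<close> type is
  the one induced by the complex structure: real scalars act through \<^const>\<open>complex_of_real\<close> and the
  real inner product is the real part of the Hermitian product. Positive definiteness of the
  Hermitian product is inherited from \<^class>\<open>real_inner\<close>. The product is conjugate-linear in the
  first argument (linearity in the second one follows from conjugate symmetry).
\<close>

class complex_inner = real_inner +
  fixes scaleC :: "complex \<Rightarrow> 'a \<Rightarrow> 'a"
    and cinner :: "'a \<Rightarrow> 'a \<Rightarrow> complex"
  assumes scaleC_add_right: "scaleC a (x + y) = scaleC a x + scaleC a y"
    and scaleC_add_left: "scaleC (a + b) x = scaleC a x + scaleC b x"
    and scaleC_scaleC: "scaleC a (scaleC b x) = scaleC (a * b) x"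
    and scaleC_of_real: "scaleC (complex_of_real r) x = scaleR r x"
    and cinner_commute: "cinner x y = cnj (cinner y x)"
    and cinner_add_left: "cinner (x + y) z = cinner x z + cinner y z"
    and cinner_scaleC_left: "cinner (scaleC a x) y = cnj a * cinner x y"
    and inner_eq_Re_cinner: "inner x y = Re (cinner x y)"

global_interpretation complex_vector: vector_space "scaleC :: complex \<Rightarrow> 'a \<Rightarrow> 'a::complex_inner"
  defines cdependent = complex_vector.dependent
    and csubspace = complex_vector.subspace
    and cspan = complex_vector.span
    and cdim = complex_vector.dim
proof unfold_locales
  fix x :: 'a
  show "scaleC 1 x = x"
    using scaleC_of_real[of 1 x] by simp
qed (simp_all add: scaleC_add_right scaleC_add_left scaleC_scaleC)

abbreviation cindependent :: "'a::complex_inner set \<Rightarrow> bool" where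
  "cindependent B \<equiv> \<not> cdependent B"


text \<open>
  Lebesgue measure on a finite-dimensional real subspace is the Lebesgue measure of a Euclidean
  coordinate space, transported by the coordinates of an orthonormal basis (as in the library's
  \<^const>\<open>lborel\<close>, which uses \<^const>\<open>Basis\<close>). The result does not depend on the orthonormal basis, so
  an arbitrary one is selected. For the zero subspace it is the counting measure on \<open>{0}\<close>.
\<close>

definition orthonormal_basis_of :: "'a::real_inner set \<Rightarrow> 'a set \<Rightarrow> bool" where
  "orthonormal_basis_of U B \<longleftrightarrow>
     finite B \<and> span B = U \<and> pairwise orthogonal B \<and> (\<forall>b\<in>B. norm b = 1)"

definition lebesgue_of :: "'a::real_inner set \<Rightarrow> 'a measure" where
  "lebesgue_of U =
     (let B = (SOME B. orthonormal_basis_of U B) in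
        embed_measure (completion (\<Pi>\<^sub>M b\<in>B. lborel)) (\<lambda>x. \<Sum>b\<in>B. x b *\<^sub>R b))"

text \<open>
  The \<open>m\<close>-dimensional measure on \<open>U\<close>, for \<open>m \<ge> dim U\<close> (real dimension); no meaning is attached to
  the value for \<open>m < dim U\<close>.
\<close>

definition measure_of_dim :: "nat \<Rightarrow> 'a::real_inner set \<Rightarrow> 'a set \<Rightarrow> ennreal" where
  "measure_of_dim m U A = (if m = dim U then emeasure (lebesgue_of U) A else 0)"


text \<open>
  The orthogonal projection on \<open>W\<close> with respect to a real or Hermitian inner product \<open>ip\<close>.
\<close>

definition orth_proj :: "('a \<Rightarrow> 'a \<Rightarrow> 'k::zero) \<Rightarrow> 'a set \<Rightarrow> 'a \<Rightarrow> 'a::ab_group_add" where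
  "orth_proj ip W x = (THE y. y \<in> W \<and> (\<forall>w\<in>W. ip (x - y) w = 0))"


text \<open>Bases of the whole space are families indexed by \<open>1, \<dots>, n\<close> with \<open>n\<close> its dimension.\<close>

definition orthogonal_basis :: "(nat \<Rightarrow> 'a::real_inner) \<Rightarrow> bool" where
  "orthogonal_basis v \<longleftrightarrow> (let J = {1..dim (UNIV :: 'a set)} in
     inj_on v J \<and> independent (v ` J) \<and> span (v ` J) = UNIV \<and>
     (\<forall>i\<in>J. \<forall>j\<in>J. i \<noteq> j \<longrightarrow> inner (v i) (v j) = 0))"

definition corthogonal_basis :: "(nat \<Rightarrow> 'a::complex_inner) \<Rightarrow> bool" where
  "corthogonal_basis v \<longleftrightarrow> (let J = {1..cdim (UNIV :: 'a set)} in
     inj_on v J \<and> cindependent (v ` J) \<and> cspan (v ` J) = UNIV \<and>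
     (\<forall>i\<in>J. \<forall>j\<in>J. i \<noteq> j \<longrightarrow> cinner (v i) (v j) = 0))"

text \<open>
  A multi-index \<open>i\<^sub>1 < \<dots> < i\<^sub>q\<close> in \<open>{1..n}\<close> is represented by the set of its entries. The empty
  multi-index (\<open>q = 0\<close>) is allowed; its coordinate subspace is the zero subspace.
\<close>

definition multi_indices :: "nat \<Rightarrow> nat \<Rightarrow> nat set set" where
  "multi_indices n q = {I. I \<subseteq> {1..n} \<and> card I = q}"

definition coord_subspace :: "(nat \<Rightarrow> 'a::real_vector) \<Rightarrow> nat set \<Rightarrow> 'a set" where
  "coord_subspace v I = span (v ` I)"

definition ccoord_subspace :: "(nat \<Rightarrow> 'a::complex_inner) \<Rightarrow> nat set \<Rightarrow> 'a set" where
  "ccoord_subspace v I = cspan (v ` I)"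

end

theory Submission
  imports Defs
begin

text \<open>
  The theorem is a Pythagorean theorem for the factors by which the coordinate projections scale the
  volume of \<open>V\<close>. It is proved without determinants.

  A linear bijection between finite-dimensional subspaces multiplies Lebesgue measure by a constant
  (\<open>linear_scales_leb\<close>, which is uniqueness of Haar measure); a linear isometry has constant \<open>1\<close>
  because it preserves the unit ball, so Lebesgue measure on a subspace may be computed in any
  orthonormal basis (\<open>lebesgue_of_eq_leb\<close>). If a linear bijection \<open>T\<close> of \<open>U\<close> onto \<open>W\<close> is extended by
  a unit vector \<open>u\<close> orthogonal to \<open>U\<close> and \<open>T u\<close> is \<open>s w\<close> plus an element of \<open>W\<close>, for a unit vector
  \<open>w\<close> orthogonal to \<open>W\<close> and \<open>s > 0\<close>, then the constant is multiplied by \<open>s\<close>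
  (\<open>scales_leb_insert\<close>, Cavalieri's principle).

  Let \<open>d\<close> be the real dimension of the field. For a subspace \<open>V\<close> of dimension \<open>p\<close> over the field,
  the projection of \<open>V\<close> on the coordinate subspace with multi-index \<open>I\<close> scales the measure by
  \<open>s\<^sub>I ^ d\<close>, where \<open>s\<^sub>I = 0\<close> if the projection is not injective on \<open>V\<close>. The claim is that the
  sum of the squares of the \<open>s\<^sub>I\<close> is \<open>1\<close> (\<open>sum_proj_factor\<close>). The proof is by induction on the
  number of coordinate lines. Let \<open>H\<close> be the span of all coordinate lines but the last one. If
  \<open>V \<subseteq> H\<close>, the multi-indices with the last index have factor \<open>0\<close>, and the others are covered by the
  induction hypothesis. Otherwise \<open>V\<close> is the orthogonal sum of \<open>V' = V \<inter> H\<close> and of the line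
  through a unit vector \<open>u = h + q\<close>, where \<open>h \<in> H\<close> and \<open>q\<close> lies on the last coordinate line.
  If \<open>I\<close> does not contain the last index, the projection factors through the projection on \<open>H\<close>, which
  has factor \<open>norm h\<close>, so that the induction hypothesis for the image of \<open>V\<close> in \<open>H\<close> shows that
  these \<open>I\<close> contribute \<open>(norm h)\<^sup>2\<close>. If \<open>I\<close> contains the last index, \<open>s\<^sub>I\<close> is \<open>norm q\<close> times the
  factor of \<open>V'\<close> for the remaining indices, so that these \<open>I\<close> contribute \<open>(norm q)\<^sup>2\<close>.
  The two contributions add up to \<open>(norm u)\<^sup>2 = 1\<close>.

  The locale \<open>line_structure\<close> treats both fields at once: lines over the field appear as real
  subspaces spanned by the orbit of a vector under \<open>{1}\<close> or under \<open>{1, \<i>}\<close>. The real case uses the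
  squared factors \<open>(s\<^sub>I ^ 1)\<^sup>2\<close>, the complex case the factors \<open>s\<^sub>I ^ 2\<close> themselves.
\<close>

section \<open>Product Lebesgue measure\<close>

interpretation lborel_product: product_sigma_finite "\<lambda>_::'i. lborel :: real measure"
  by standard

abbreviation lborel_Pi :: "'i set \<Rightarrow> ('i \<Rightarrow> real) measure" where
  "lborel_Pi B \<equiv> \<Pi>\<^sub>M b\<in>B. lborel"

lemma space_lborel_Pi: "space (lborel_Pi B) = PiE B (\<lambda>_. UNIV)"
  by (simp add: space_PiM)

lemma restrict_add_measurable [measurable]:
  "(\<lambda>x. \<lambda>b\<in>B. x b + t b) \<in> lborel_Pi B \<rightarrow>\<^sub>M lborel_Pi B"
  by (rule measurable_restrict) simp

lemma distr_translate_lborel_Pi: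
  assumes "finite B"
  shows "distr (lborel_Pi B) (lborel_Pi B) (\<lambda>x. \<lambda>b\<in>B. x b + t b) = lborel_Pi B"
proof (rule lborel_product.PiM_eqI[OF assms])
  fix A :: "'a \<Rightarrow> real set" assume A: "\<And>i. i \<in> B \<Longrightarrow> A i \<in> sets lborel"
  have "emeasure (distr (lborel_Pi B) (lborel_Pi B) (\<lambda>x. \<lambda>b\<in>B. x b + t b)) (PiE B A)
      = emeasure (lborel_Pi B) ((\<lambda>x. \<lambda>b\<in>B. x b + t b) -` PiE B A \<inter> space (lborel_Pi B))"
    using A assms by (intro emeasure_distr restrict_add_measurable sets_PiM_I_finite) auto
  also have "(\<lambda>x. \<lambda>b\<in>B. x b + t b) -` PiE B A \<inter> space (lborel_Pi B)
      = PiE B (\<lambda>b. (\<lambda>x. x + t b) -` A b)"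
    unfolding space_lborel_Pi by (auto simp: PiE_iff extensional_def)
  also have "emeasure (lborel_Pi B) \<dots> = (\<Prod>b\<in>B. emeasure lborel ((\<lambda>x. x + t b) -` A b))"
  proof (rule lborel_product.emeasure_PiM[OF assms])
    fix b assume "b \<in> B"
    then have [measurable]: "A b \<in> sets borel" using A by simp
    have "(\<lambda>x. x + t b) -` A b \<inter> space lborel \<in> sets lborel" by measurable
    then show "(\<lambda>x. x + t b) -` A b \<in> sets lborel" by simp
  qed
  also have "\<dots> = (\<Prod>b\<in>B. emeasure lborel (A b))"
  proof (rule prod.cong)
    fix b assume b: "b \<in> B"
    have "emeasure lborel (A b) = emeasure (distr lborel borel ((+) (t b))) (A b)"
      by (simp add: lborel_distr_plus)
    also have "(+) (t b) = (\<lambda>x. x + t b)"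
      by (simp add: fun_eq_iff)
    also have "emeasure (distr lborel borel (\<lambda>x. x + t b)) (A b) = emeasure lborel ((\<lambda>x. x + t b) -` A b)"
      using A[OF b] by (subst emeasure_distr) auto
    finally show "emeasure lborel ((\<lambda>x. x + t b) -` A b) = emeasure lborel (A b)" ..
  qed simp
  finally show "emeasure (distr (lborel_Pi B) (lborel_Pi B) (\<lambda>x. \<lambda>b\<in>B. x b + t b)) (PiE B A)
      = (\<Prod>b\<in>B. emeasure lborel (A b))" .
qed simp

lemma nn_integral_translate_lborel_Pi:
  assumes "finite B" "f \<in> borel_measurable (lborel_Pi B)"
  shows "(\<integral>\<^sup>+x. f (\<lambda>b\<in>B. x b + t b) \<partial>lborel_Pi B) = (\<integral>\<^sup>+x. f x \<partial>lborel_Pi B)"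
proof -
  have "(\<integral>\<^sup>+x. f x \<partial>lborel_Pi B) =
     (\<integral>\<^sup>+x. f x \<partial>distr (lborel_Pi B) (lborel_Pi B) (\<lambda>x. \<lambda>b\<in>B. x b + t b))"
    by (simp add: distr_translate_lborel_Pi[OF assms(1)])
  also have "\<dots> = (\<integral>\<^sup>+x. f (\<lambda>b\<in>B. x b + t b) \<partial>lborel_Pi B)"
    using assms by (intro nn_integral_distr restrict_add_measurable) auto
  finally show ?thesis ..
qed

lemma emeasure_cube_lborel_Pi:
  assumes "finite B" "0 \<le> d"
  shows "emeasure (lborel_Pi B) (PiE B (\<lambda>_. {-d..d})) = ennreal ((2 * d) ^ card B)"
  using assms
  by (subst lborel_product.emeasure_PiM) (auto simp: ennreal_power)

lemma emeasure_unit_cube_lborel_Pi: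
  assumes "finite B"
  shows "emeasure (lborel_Pi B) (PiE B (\<lambda>_. {0..1})) = 1"
  using assms by (subst lborel_product.emeasure_PiM) auto

lemma nn_integral_indicator_vimage:
  assumes "f \<in> M \<rightarrow>\<^sub>M N" "A \<in> sets N"
  shows "(\<integral>\<^sup>+x. indicator A (f x) \<partial>M) = emeasure M (f -` A \<inter> space M)"
proof -
  have "(\<integral>\<^sup>+x. indicator A (f x) \<partial>M) = (\<integral>\<^sup>+x. indicator (f -` A \<inter> space M) x \<partial>M)"
    by (rule nn_integral_cong) (simp add: indicator_def)
  also have "\<dots> = emeasure M (f -` A \<inter> space M)"
    by (rule nn_integral_indicator) (rule measurable_sets[OF assms])
  finally show ?thesis .
qed

text \<open>
  The exchange argument behind the uniqueness of Haar measure. The map \<open>g\<close> is thought of as an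
  additive bijection with inverse \<open>h\<close>. Both sides equal the double integral of
  \<open>indicator A x * indicator E (y + g x)\<close>: integrating first in \<open>y\<close> gives the left side, while the
  translations by \<open>- h y\<close> in \<open>x\<close> and then by \<open>g x\<close> in \<open>y\<close> give the right side.
\<close>
lemma haar_exchange:
  fixes g :: "('i \<Rightarrow> real) \<Rightarrow> ('j \<Rightarrow> real)" and h :: "('j \<Rightarrow> real) \<Rightarrow> ('i \<Rightarrow> real)"
  assumes fin: "finite C" "finite B"
    and g [measurable]: "g \<in> lborel_Pi C \<rightarrow>\<^sub>M lborel_Pi B"
    and h [measurable]: "h \<in> lborel_Pi B \<rightarrow>\<^sub>M lborel_Pi C"
    and g_diff: "\<And>x y. x \<in> space (lborel_Pi C) \<Longrightarrow> y \<in> space (lborel_Pi B) \<Longrightarrow>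
        g (\<lambda>c\<in>C. x c - h y c) = (\<lambda>b\<in>B. g x b - y b)"
    and h_add: "\<And>x y. x \<in> space (lborel_Pi C) \<Longrightarrow> y \<in> space (lborel_Pi B) \<Longrightarrow>
        h (\<lambda>b\<in>B. y b + g x b) = (\<lambda>c\<in>C. h y c + x c)"
    and A [measurable]: "A \<in> sets (lborel_Pi C)" and E [measurable]: "E \<in> sets (lborel_Pi B)"
  shows "emeasure (lborel_Pi C) A * emeasure (lborel_Pi B) E =
     emeasure (lborel_Pi C) (g -` E \<inter> space (lborel_Pi C)) *
     emeasure (lborel_Pi B) ((\<lambda>y. \<lambda>c\<in>C. - h y c) -` A \<inter> space (lborel_Pi B))"
proof -
  interpret M: sigma_finite_measure "lborel_Pi C" by (rule lborel_product.sigma_finite[OF fin(1)])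
  interpret N: sigma_finite_measure "lborel_Pi B" by (rule lborel_product.sigma_finite[OF fin(2)])
  interpret MN: pair_sigma_finite "lborel_Pi C" "lborel_Pi B" ..
  have gc [measurable]: "(\<lambda>x. g x b) \<in> borel_measurable (lborel_Pi C)" if "b \<in> B" for b
    using measurable_compose[OF g measurable_component_singleton[OF that]] by simp
  have hc [measurable]: "(\<lambda>x. h x c) \<in> borel_measurable (lborel_Pi B)" if "c \<in> C" for c
    using measurable_compose[OF h measurable_component_singleton[OF that]] by simp
  have add_m [measurable]: "(\<lambda>(x, y). \<lambda>b\<in>B. y b + g x b) \<in> lborel_Pi C \<Otimes>\<^sub>M lborel_Pi B \<rightarrow>\<^sub>M lborel_Pi B"
    unfolding split_beta' by (rule measurable_restrict) measurable
  have sub_m [measurable]: "(\<lambda>(x, y). \<lambda>c\<in>C. x c - h y c) \<in> lborel_Pi C \<Otimes>\<^sub>M lborel_Pi B \<rightarrow>\<^sub>M lborel_Pi C"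
    unfolding split_beta' by (rule measurable_restrict) measurable
  have neg_m [measurable]: "(\<lambda>y. \<lambda>c\<in>C. - h y c) \<in> lborel_Pi B \<rightarrow>\<^sub>M lborel_Pi C"
    by (rule measurable_restrict) measurable
  have A_ind [measurable]: "indicator A \<in> borel_measurable (lborel_Pi C)"
    and E_ind [measurable]: "indicator E \<in> borel_measurable (lborel_Pi B)" by simp_all
  have add1 [measurable]: "(\<lambda>y. \<lambda>b\<in>B. y b + g x b) \<in> lborel_Pi B \<rightarrow>\<^sub>M lborel_Pi B" for x
    by (rule restrict_add_measurable)
  have i1: "(\<lambda>(x, y). indicator A x * indicator E (\<lambda>b\<in>B. y b + g x b) :: ennreal)
      \<in> borel_measurable (lborel_Pi C \<Otimes>\<^sub>M lborel_Pi B)"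
    using measurable_compose[OF add_m E_ind] measurable_compose[OF measurable_fst A_ind]
    by (simp add: split_beta')
  have i2: "(\<lambda>(x, y). indicator A (\<lambda>c\<in>C. x c - h y c) * indicator E (g x) :: ennreal)
      \<in> borel_measurable (lborel_Pi C \<Otimes>\<^sub>M lborel_Pi B)"
    using measurable_compose[OF sub_m A_ind]
      measurable_compose[OF measurable_compose[OF measurable_fst g] E_ind]
    by (simp add: split_beta')
  have gE [measurable]: "(\<lambda>x. indicator E (g x) :: ennreal) \<in> borel_measurable (lborel_Pi C)"
    by (rule measurable_compose[OF g E_ind])
  have hA [measurable]: "(\<lambda>y. indicator A (\<lambda>c\<in>C. - h y c) :: ennreal) \<in> borel_measurable (lborel_Pi B)"
    by (rule measurable_compose[OF neg_m A_ind])
  have "emeasure (lborel_Pi C) A * emeasure (lborel_Pi B) E =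
      (\<integral>\<^sup>+x. indicator A x * (\<integral>\<^sup>+y. indicator E y \<partial>lborel_Pi B) \<partial>lborel_Pi C)"
    by (simp add: nn_integral_multc)
  also have "\<dots> = (\<integral>\<^sup>+x. indicator A x * (\<integral>\<^sup>+y. indicator E (\<lambda>b\<in>B. y b + g x b) \<partial>lborel_Pi B) \<partial>lborel_Pi C)"
    using nn_integral_translate_lborel_Pi[OF fin(2) E_ind, symmetric] by simp
  also have "\<dots> = (\<integral>\<^sup>+x. \<integral>\<^sup>+y. indicator A x * indicator E (\<lambda>b\<in>B. y b + g x b) \<partial>lborel_Pi B \<partial>lborel_Pi C)"
    by (intro nn_integral_cong nn_integral_cmult[symmetric] measurable_compose[OF add1 E_ind])
  also have "\<dots> = (\<integral>\<^sup>+y. \<integral>\<^sup>+x. indicator A x * indicator E (\<lambda>b\<in>B. y b + g x b) \<partial>lborel_Pi C \<partial>lborel_Pi B)"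
    by (rule MN.Fubini'[OF i1, symmetric])
  also have "\<dots> = (\<integral>\<^sup>+y. \<integral>\<^sup>+x. indicator A (\<lambda>c\<in>C. x c - h y c) * indicator E (g x) \<partial>lborel_Pi C \<partial>lborel_Pi B)"
  proof (rule nn_integral_cong)
    fix y assume y: "y \<in> space (lborel_Pi B)"
    let ?f = "\<lambda>x. indicator A x * indicator E (\<lambda>b\<in>B. y b + g x b) :: ennreal"
    have f: "?f \<in> borel_measurable (lborel_Pi C)"
      using measurable_compose[OF measurable_Pair2'[OF y, of "lborel_Pi C"] i1] by simp
    have yy: "(\<lambda>b\<in>B. y b + (g x b - y b)) = g x" if "x \<in> space (lborel_Pi C)" for x
      using measurable_space[OF g that] by (auto simp: space_PiM PiE_iff extensional_def)
    have "(\<integral>\<^sup>+x. ?f x \<partial>lborel_Pi C) = (\<integral>\<^sup>+x. ?f (\<lambda>c\<in>C. x c + (- h y c)) \<partial>lborel_Pi C)"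
      by (rule nn_integral_translate_lborel_Pi[OF fin(1) f, symmetric])
    also have "\<dots> = (\<integral>\<^sup>+x. indicator A (\<lambda>c\<in>C. x c - h y c) * indicator E (g x) \<partial>lborel_Pi C)"
      by (rule nn_integral_cong) (use g_diff[OF _ y] yy in \<open>simp cong: restrict_cong\<close>)
    finally show "(\<integral>\<^sup>+x. ?f x \<partial>lborel_Pi C) =
       (\<integral>\<^sup>+x. indicator A (\<lambda>c\<in>C. x c - h y c) * indicator E (g x) \<partial>lborel_Pi C)" .
  qed
  also have "\<dots> = (\<integral>\<^sup>+x. \<integral>\<^sup>+y. indicator A (\<lambda>c\<in>C. x c - h y c) * indicator E (g x) \<partial>lborel_Pi B \<partial>lborel_Pi C)"
    by (rule MN.Fubini'[OF i2])
  also have "\<dots> = (\<integral>\<^sup>+x. \<integral>\<^sup>+y. indicator A (\<lambda>c\<in>C. - h y c) * indicator E (g x) \<partial>lborel_Pi B \<partial>lborel_Pi C)"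
  proof (rule nn_integral_cong)
    fix x assume x: "x \<in> space (lborel_Pi C)"
    let ?f = "\<lambda>y. indicator A (\<lambda>c\<in>C. x c - h y c) * indicator E (g x) :: ennreal"
    have f: "?f \<in> borel_measurable (lborel_Pi B)"
      using measurable_compose[OF measurable_Pair1'[OF x] i2] by simp
    have "(\<integral>\<^sup>+y. ?f y \<partial>lborel_Pi B) = (\<integral>\<^sup>+y. ?f (\<lambda>b\<in>B. y b + g x b) \<partial>lborel_Pi B)"
      by (rule nn_integral_translate_lborel_Pi[OF fin(2) f, symmetric])
    also have "\<dots> = (\<integral>\<^sup>+y. indicator A (\<lambda>c\<in>C. - h y c) * indicator E (g x) \<partial>lborel_Pi B)"
      by (rule nn_integral_cong) (use h_add[OF x] in \<open>simp cong: restrict_cong\<close>)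
    finally show "(\<integral>\<^sup>+y. ?f y \<partial>lborel_Pi B) =
      (\<integral>\<^sup>+y. indicator A (\<lambda>c\<in>C. - h y c) * indicator E (g x) \<partial>lborel_Pi B)" .
  qed
  also have "\<dots> = (\<integral>\<^sup>+x. indicator E (g x) \<partial>lborel_Pi C) * (\<integral>\<^sup>+y. indicator A (\<lambda>c\<in>C. - h y c) \<partial>lborel_Pi B)"
    by (simp add: nn_integral_multc nn_integral_cmult mult.commute)
  also have "(\<integral>\<^sup>+x. indicator E (g x) \<partial>lborel_Pi C) = emeasure (lborel_Pi C) (g -` E \<inter> space (lborel_Pi C))"
    by (rule nn_integral_indicator_vimage[OF g E])
  also have "(\<integral>\<^sup>+y. indicator A (\<lambda>c\<in>C. - h y c) \<partial>lborel_Pi B)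
      = emeasure (lborel_Pi B) ((\<lambda>y. \<lambda>c\<in>C. - h y c) -` A \<inter> space (lborel_Pi B))"
    by (rule nn_integral_indicator_vimage[OF neg_m A])
  finally show ?thesis .
qed


section \<open>Lebesgue measure in an orthonormal basis\<close>

definition orthonormal :: "'a::real_inner set \<Rightarrow> bool" where
  "orthonormal B \<longleftrightarrow> finite B \<and> pairwise orthogonal B \<and> (\<forall>b\<in>B. norm b = 1)"

text \<open>
  The synthesis map from coordinate functions on \<open>B\<close> to vectors, the analysis map, and their
  composite, which for orthonormal \<open>B\<close> is the orthogonal projection on \<open>span B\<close>. Coordinate
  functions are restricted to \<open>B\<close>, as the elements of the product measure space are.
\<close>
definition comb :: "'a::real_inner set \<Rightarrow> ('a \<Rightarrow> real) \<Rightarrow> 'a" where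
  "comb B x = (\<Sum>b\<in>B. x b *\<^sub>R b)"

definition coords :: "'a::real_inner set \<Rightarrow> 'a \<Rightarrow> ('a \<Rightarrow> real)" where
  "coords B v = (\<lambda>b\<in>B. inner v b)"

definition proj :: "'a::real_inner set \<Rightarrow> 'a \<Rightarrow> 'a" where
  "proj B v = (\<Sum>b\<in>B. inner v b *\<^sub>R b)"

lemma orthonormal_basis_of_iff: "orthonormal_basis_of U B \<longleftrightarrow> orthonormal B \<and> span B = U"
  by (auto simp: orthonormal_basis_of_def orthonormal_def)

lemma orthonormal_finite: "orthonormal B \<Longrightarrow> finite B"
  by (simp add: orthonormal_def)

lemma orthonormal_norm: "orthonormal B \<Longrightarrow> b \<in> B \<Longrightarrow> norm b = 1"
  by (simp add: orthonormal_def)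

lemma orthonormal_inner:
  "orthonormal B \<Longrightarrow> b \<in> B \<Longrightarrow> c \<in> B \<Longrightarrow> inner b c = (if b = c then 1 else 0)"
  by (auto simp: orthonormal_def pairwise_def orthogonal_def dot_square_norm)

lemma orthonormal_insert:
  "orthonormal (insert u B) \<longleftrightarrow> orthonormal B \<and> norm u = 1 \<and> (\<forall>b\<in>B. b \<noteq> u \<longrightarrow> inner u b = 0)"
  by (auto simp: orthonormal_def pairwise_insert orthogonal_def inner_commute)

lemma orthonormal_independent: "orthonormal B \<Longrightarrow> independent B"
  by (rule pairwise_orthogonal_independent) (auto simp: orthonormal_def)

lemma dim_span_orthonormal: "orthonormal B \<Longrightarrow> dim (span B) = card B"
  by (simp add: dim_eq_card_independent orthonormal_independent)

lemma linear_comb_image: "linear T \<Longrightarrow> T (comb B x) = (\<Sum>b\<in>B. x b *\<^sub>R T b)"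
  by (simp add: comb_def linear_sum linear_scale)

lemma comb_inner: "orthonormal B \<Longrightarrow> b \<in> B \<Longrightarrow> inner (comb B x) b = x b"
  by (simp add: comb_def inner_sum_left orthonormal_inner orthonormal_finite
      if_distrib[of "\<lambda>t. _ * t"] cong: if_cong)

lemma comb_in_span: "comb B x \<in> span B"
  unfolding comb_def by (intro span_sum span_scale span_base)

lemma proj_eq_comb: "proj B v = comb B (coords B v)"
  by (simp add: proj_def comb_def coords_def)

lemma proj_in_span: "proj B v \<in> span B"
  by (simp add: proj_eq_comb comb_in_span)

lemma linear_proj: "linear (proj B)"
  unfolding proj_def
  by (rule linearI) (simp_all add: inner_add_left scaleR_left_distrib sum.distrib scaleR_sum_right)

lemma inner_span_zero: "(\<And>b. b \<in> B \<Longrightarrow> inner x b = 0) \<Longrightarrow> y \<in> span B \<Longrightarrow> inner x y = 0"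
  using orthogonal_to_span[of y B x] by (simp add: orthogonal_def)

lemma proj_residual: "orthonormal B \<Longrightarrow> y \<in> span B \<Longrightarrow> inner (x - proj B x) y = 0"
  by (erule inner_span_zero[rotated])
    (simp add: inner_diff_left proj_eq_comb comb_inner, simp add: coords_def)

lemma proj_unique:
  assumes "orthonormal B" "y \<in> span B" "\<And>b. b \<in> B \<Longrightarrow> inner (x - y) b = 0"
  shows "proj B x = y"
proof -
  have *: "proj B x - y \<in> span B"
    using assms(2) proj_in_span by (rule span_diff[rotated])
  have "inner (x - y) (proj B x - y) = 0"
    by (rule inner_span_zero[OF assms(3) *])
  moreover have "inner (x - proj B x) (proj B x - y) = 0"
    by (rule proj_residual[OF assms(1) *])
  ultimately have "inner (proj B x - y) (proj B x - y) = 0"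
    by (simp add: inner_diff_left)
  then show ?thesis by simp
qed

lemma proj_id: "orthonormal B \<Longrightarrow> x \<in> span B \<Longrightarrow> proj B x = x"
  by (rule proj_unique) auto

lemma proj_zero: "(\<And>b. b \<in> B \<Longrightarrow> inner x b = 0) \<Longrightarrow> proj B x = 0"
  by (simp add: proj_def)

lemma comb_coords: "orthonormal B \<Longrightarrow> v \<in> span B \<Longrightarrow> comb B (coords B v) = v"
  using proj_id[of B v] by (simp add: proj_eq_comb)

lemma coords_comb: "orthonormal B \<Longrightarrow> x \<in> PiE B (\<lambda>_. UNIV) \<Longrightarrow> coords B (comb B x) = x"
  by (auto simp: coords_def comb_inner PiE_iff extensional_def)

lemma coords_in: "coords B v \<in> PiE B (\<lambda>_. UNIV)"
  by (auto simp: coords_def)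

lemma norm_eq_coords:
  assumes "orthonormal B" "v \<in> span B"
  shows "(norm v)\<^sup>2 = (\<Sum>b\<in>B. (inner v b)\<^sup>2)"
proof -
  have "(norm v)\<^sup>2 = inner (proj B v) v"
    using assms by (simp add: proj_id dot_square_norm)
  also have "\<dots> = (\<Sum>b\<in>B. (inner v b)\<^sup>2)"
    by (simp add: proj_def inner_sum_left inner_sum_right inner_commute[of _ v] power2_eq_square)
  finally show ?thesis .
qed

lemma orthonormal_basis_exists:
  fixes F :: "'a::real_inner set"
  assumes "finite F" "subspace V" "V \<subseteq> span F"
  obtains B where "orthonormal B" "span B = V"
proof -
  obtain A where A: "A \<subseteq> V" "independent A" "V \<subseteq> span A"
    using basis_exists[of V] by metis
  have "finite A"
    using independent_span_bound[OF assms(1) A(2)] A(1) assms(3) by auto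
  then obtain C where C: "finite C" "span C = span A" "pairwise orthogonal C"
    using basis_orthogonal by metis
  let ?n = "\<lambda>x::'a. x /\<^sub>R norm x"
  define B where "B = ?n ` (C - {0})"
  have "orthonormal B"
    unfolding orthonormal_def
  proof (intro conjI)
    show "finite B" using C by (simp add: B_def)
    show "pairwise orthogonal B"
    proof (rule pairwiseI)
      fix x y assume "x \<in> B" "y \<in> B" "x \<noteq> y"
      then obtain a b where "a \<in> C" "b \<in> C" "x = ?n a" "y = ?n b" "a \<noteq> b"
        by (auto simp: B_def)
      with C(3) show "orthogonal x y"
        by (auto simp: pairwise_def orthogonal_def)
    qed
    show "\<forall>b\<in>B. norm b = 1" by (auto simp: B_def)
  qed
  moreover have "span B = V"
  proof
    have "B \<subseteq> span C"
      unfolding B_def by (auto intro: span_scale span_base)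
    then have "span B \<subseteq> span C" by (simp add: span_minimal)
    then show "span B \<subseteq> V"
      using C(2) span_minimal[OF A(1) assms(2)] by auto
    have "x \<in> span B" if "x \<in> C" for x
    proof (cases "x = 0")
      case False
      then have "norm x *\<^sub>R ?n x \<in> span B"
        using that unfolding B_def by (intro span_scale span_base) auto
      with False show ?thesis by simp
    qed (simp add: span_zero)
    then have "span C \<subseteq> span B"
      by (simp add: span_minimal subsetI)
    with C(2) A(3) show "V \<subseteq> span B" by auto
  qed
  ultimately show ?thesis by (rule that)
qed


text \<open>
  Lebesgue measure on \<open>span B\<close>, computed in the orthonormal basis \<open>B\<close>.
\<close>
definition leb :: "'a::real_inner set \<Rightarrow> 'a measure" where
  "leb B = embed_measure (completion (lborel_Pi B)) (comb B)"

lemma comb_inj: "orthonormal B \<Longrightarrow> inj_on (comb B) (PiE B (\<lambda>_. UNIV))"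
  by (rule inj_on_inverseI) (rule coords_comb)

lemma comb_image: "orthonormal B \<Longrightarrow> comb B ` PiE B (\<lambda>_. UNIV) = span B"
proof (intro equalityI subsetI)
  fix v assume "orthonormal B" "v \<in> span B"
  then show "v \<in> comb B ` PiE B (\<lambda>_. UNIV)"
    using comb_coords coords_in by (metis image_eqI)
qed (auto intro: comb_in_span)

lemma space_leb: "orthonormal B \<Longrightarrow> space (leb B) = span B"
  by (simp add: leb_def space_embed_measure space_lborel_Pi comb_image)

lemma comb_image_coords: "orthonormal B \<Longrightarrow> S \<subseteq> span B \<Longrightarrow> comb B ` coords B ` S = S"
  by (simp add: image_image comb_coords subset_iff cong: image_cong)

lemma coords_image_comb: "orthonormal B \<Longrightarrow> A \<subseteq> PiE B (\<lambda>_. UNIV) \<Longrightarrow> coords B ` comb B ` A = A"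
  by (simp add: image_image coords_comb subset_iff cong: image_cong)

lemma sets_leb:
  assumes "orthonormal B"
  shows "S \<in> sets (leb B) \<longleftrightarrow> S \<subseteq> span B \<and> coords B ` S \<in> sets (completion (lborel_Pi B))"
proof -
  have *: "sets (leb B) = {comb B ` A |A. A \<in> sets (completion (lborel_Pi B))}"
    unfolding leb_def using comb_inj[OF assms]
    by (intro sets_embed_measure') (simp add: space_lborel_Pi)
  have **: "A \<subseteq> PiE B (\<lambda>_. UNIV)" if "A \<in> sets (completion (lborel_Pi B))" for A
    using sets.sets_into_space[OF that] by (simp add: space_lborel_Pi)
  show ?thesis
  proof
    assume "S \<in> sets (leb B)"
    then obtain A where A: "S = comb B ` A" "A \<in> sets (completion (lborel_Pi B))"
      unfolding * by blast
    then show "S \<subseteq> span B \<and> coords B ` S \<in> sets (completion (lborel_Pi B))"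
      using coords_image_comb[OF assms **[OF A(2)]] by (auto intro: comb_in_span)
  next
    assume S: "S \<subseteq> span B \<and> coords B ` S \<in> sets (completion (lborel_Pi B))"
    then have "S = comb B ` coords B ` S"
      using comb_image_coords[OF assms] by simp
    with S show "S \<in> sets (leb B)"
      unfolding * by blast
  qed
qed

lemma emeasure_leb:
  assumes "orthonormal B" "S \<in> sets (leb B)"
  shows "emeasure (leb B) S = emeasure (completion (lborel_Pi B)) (coords B ` S)"
proof -
  have "S \<subseteq> span B" using assms sets_leb by blast
  have "comb B -` S \<inter> space (lborel_Pi B) = coords B ` S"
  proof (intro equalityI subsetI)
    fix x assume "x \<in> comb B -` S \<inter> space (lborel_Pi B)"
    then have "x = coords B (comb B x)" "comb B x \<in> S"
      using coords_comb[OF assms(1)] by (simp_all add: space_lborel_Pi)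
    then show "x \<in> coords B ` S" by (rule image_eqI)
  next
    fix x assume "x \<in> coords B ` S"
    then obtain v where "v \<in> S" "x = coords B v" by blast
    with \<open>S \<subseteq> span B\<close> show "x \<in> comb B -` S \<inter> space (lborel_Pi B)"
      using comb_coords[OF assms(1), of v] coords_in[of B v] by (auto simp: space_lborel_Pi)
  qed
  then show ?thesis
    using assms comb_inj[OF assms(1)] unfolding leb_def
    by (subst emeasure_embed_measure') (simp_all add: space_lborel_Pi)
qed

lemma leb_comb_image:
  assumes "orthonormal B" "A \<in> sets (lborel_Pi B)"
  shows "comb B ` A \<in> sets (leb B)" "emeasure (leb B) (comb B ` A) = emeasure (lborel_Pi B) A"
proof -
  have A: "A \<subseteq> PiE B (\<lambda>_. UNIV)"
    using sets.sets_into_space[OF assms(2)] by (simp add: space_lborel_Pi)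
  show *: "comb B ` A \<in> sets (leb B)"
    using assms A by (auto simp: sets_leb coords_image_comb comb_in_span)
  show "emeasure (leb B) (comb B ` A) = emeasure (lborel_Pi B) A"
    using assms A by (simp add: emeasure_leb[OF assms(1) *] coords_image_comb)
qed

text \<open>The unit cube spanned by \<open>B\<close>; its image determines the constant of a linear map.\<close>
definition cube :: "'a::real_inner set \<Rightarrow> 'a set" where
  "cube B = comb B ` PiE B (\<lambda>_. {0..1})"

lemma cube_leb:
  assumes "orthonormal B"
  shows "cube B \<in> sets (leb B)" "emeasure (leb B) (cube B) = 1"
  using leb_comb_image[OF assms, of "PiE B (\<lambda>_. {0..1})"] assms
  by (auto simp: cube_def emeasure_unit_cube_lborel_Pi orthonormal_finite intro!: sets_PiM_I_finite)


text \<open>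
  The map \<open>T\<close> carries measurable sets to measurable sets and multiplies their measure by \<open>k\<close>.
\<close>
definition scales_volume :: "('a \<Rightarrow> 'b) \<Rightarrow> 'a measure \<Rightarrow> 'b measure \<Rightarrow> real \<Rightarrow> bool" where
  "scales_volume T M N k \<longleftrightarrow>
     0 \<le> k \<and> (\<forall>S\<in>sets M. T ` S \<in> sets N \<and> emeasure N (T ` S) = ennreal k * emeasure M S)"

lemma scales_volume_compose:
  assumes "scales_volume T M N k" "scales_volume T' N L k'"
  shows "scales_volume (\<lambda>x. T' (T x)) M L (k' * k)"
proof -
  have "(\<lambda>x. T' (T x)) ` S = T' ` T ` S" for S by auto
  then show ?thesis
    using assms by (auto simp: scales_volume_def ennreal_mult mult.assoc)
qed

lemma scales_volume_cong:
  assumes "scales_volume T M N k" "\<And>x. x \<in> space M \<Longrightarrow> T x = T' x"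
  shows "scales_volume T' M N k"
proof -
  have "T' ` S = T ` S" if "S \<in> sets M" for S
    using sets.sets_into_space[OF that] assms(2) by (auto intro!: image_cong)
  then show ?thesis using assms(1) by (auto simp: scales_volume_def)
qed

lemma scales_volume_leb_factor:
  assumes "orthonormal B" "scales_volume T (leb B) N k"
  shows "emeasure N (T ` cube B) = ennreal k"
  using assms cube_leb[OF assms(1)] by (simp add: scales_volume_def)

lemma image_completion:
  assumes g: "\<And>S. S \<in> sets M \<Longrightarrow> g ` S \<in> sets N"
    "\<And>S. S \<in> sets M \<Longrightarrow> emeasure N (g ` S) = k * emeasure M S"
    and S: "S \<in> sets (completion M)"
  shows "g ` S \<in> sets (completion N)"
    "emeasure (completion N) (g ` S) = k * emeasure (completion M) S"
proof -
  obtain S1 N1 N2 where *: "S = S1 \<union> N1" "N1 \<subseteq> N2" "N2 \<in> null_sets M" "S1 \<in> sets M"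
    using S by (rule sets_completionE)
  have N2: "g ` N2 \<in> null_sets N"
    using *(3) g by (auto simp: null_sets_def)
  have n1: "N1 \<in> null_sets (completion M)" and n2: "g ` N1 \<in> null_sets (completion N)"
    using * N2 null_sets_completion_subset null_sets_completionI by (metis image_mono)+
  have im: "g ` S = g ` S1 \<union> g ` N1" using * by auto
  show "g ` S \<in> sets (completion N)"
    using g(1)[OF *(4)] n2 by (auto simp: im)
  have "emeasure (completion N) (g ` S) = emeasure (completion N) (g ` S1)"
    using emeasure_Un_null_set[OF _ n2] g(1)[OF *(4)] by (simp add: im)
  also have "\<dots> = k * emeasure M S1"
    using g *(4) by simp
  also have "emeasure M S1 = emeasure (completion M) S"
    using emeasure_Un_null_set[OF _ n1] *(4) by (simp add: *(1))
  finally show "emeasure (completion N) (g ` S) = k * emeasure (completion M) S" .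
qed

lemma comb_diff: "comb B (\<lambda>b\<in>B. x b - y b) = comb B x - comb B y"
  by (simp add: comb_def scaleR_diff_left sum_subtractf)

lemma comb_add: "comb B (\<lambda>b\<in>B. x b + y b) = comb B x + comb B y"
  by (simp add: comb_def scaleR_left_distrib sum.distrib)

lemma measurable_coords_linear:
  assumes "linear T" "finite B" "finite C"
  shows "(\<lambda>x. coords C (T (comb B x))) \<in> lborel_Pi B \<rightarrow>\<^sub>M lborel_Pi C"
  unfolding coords_def
proof (rule measurable_restrict)
  fix c assume "c \<in> C"
  have "(\<lambda>x. inner (T (comb B x)) c) = (\<lambda>x. \<Sum>b\<in>B. x b * inner (T b) c)"
    by (simp add: linear_comb_image[OF assms(1)] inner_sum_left)
  also have "\<dots> \<in> lborel_Pi B \<rightarrow>\<^sub>M lborel"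
    by measurable
  finally show "(\<lambda>x. inner (T (comb B x)) c) \<in> lborel_Pi B \<rightarrow>\<^sub>M lborel" .
qed

lemma linear_inverse_on:
  assumes "linear T" "subspace U" "inj_on T U" "T ` U = W"
  obtains T' where "linear T'" "\<And>x. T' x \<in> U" "\<And>x. x \<in> U \<Longrightarrow> T' (T x) = x"
    "\<And>y. y \<in> W \<Longrightarrow> T (T' y) = y"
proof -
  obtain T' where "range T' \<subseteq> U" "linear T'" "\<forall>v\<in>U. T' (T v) = v"
    using linear_exists_left_inverse_on[of T U] assms by blast
  with assms show ?thesis by (intro that[of T']) auto
qed

text \<open>
  In coordinates the map is a measurable additive bijection \<open>g\<close>, and exchanging the unit cube with
  an arbitrary Borel set gives the constant.
\<close>
proposition linear_scales_leb:
  fixes T :: "'a::real_inner \<Rightarrow> 'b::real_inner"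
  assumes B: "orthonormal B" and C: "orthonormal C" and T: "linear T" "inj_on T (span B)" "T ` span B = span C"
  obtains k where "0 < k" "scales_volume T (leb B) (leb C) k"
proof -
  obtain T' where T': "linear T'" "\<And>x. T' x \<in> span B" "\<And>x. x \<in> span B \<Longrightarrow> T' (T x) = x"
    "\<And>y. y \<in> span C \<Longrightarrow> T (T' y) = y"
    using linear_inverse_on[OF T(1) subspace_span T(2,3)] by metis
  note fin = orthonormal_finite[OF B] orthonormal_finite[OF C]
  define g where "g x = coords C (T (comb B x))" for x
  define h where "h y = coords B (T' (comb C y))" for y
  have Tspan: "T x \<in> span C" if "x \<in> span B" for x using T(3) that by blast
  have comb_g: "comb C (g x) = T (comb B x)" for x
    by (simp add: g_def comb_coords C Tspan comb_in_span)
  have comb_h: "comb B (h y) = T' (comb C y)" for y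
    by (simp add: h_def comb_coords B T'(2))
  have hg: "h (g x) = x" if "x \<in> space (lborel_Pi B)" for x
    using that by (simp add: h_def comb_g T'(3) comb_in_span coords_comb B space_lborel_Pi)
  have gh: "g (h y) = y" if "y \<in> space (lborel_Pi C)" for y
    using that by (simp add: g_def comb_h T'(4) comb_in_span coords_comb C space_lborel_Pi)
  have g: "g \<in> lborel_Pi B \<rightarrow>\<^sub>M lborel_Pi C" and h: "h \<in> lborel_Pi C \<rightarrow>\<^sub>M lborel_Pi B"
    using measurable_coords_linear[OF T(1) fin] measurable_coords_linear[OF T'(1) fin(2,1)]
    by (simp_all add: g_def[abs_def] h_def[abs_def])
  have gd: "g (\<lambda>b\<in>B. x b - h y b) = (\<lambda>c\<in>C. g x c - y c)"
    if "y \<in> space (lborel_Pi C)" for x y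
  proof -
    have "g (\<lambda>b\<in>B. x b - h y b) = coords C (T (comb B x) - comb C y)"
      by (simp add: g_def comb_diff comb_h linear_diff[OF T(1)] T'(4) comb_in_span)
    also have "\<dots> = (\<lambda>c\<in>C. g x c - y c)"
      by (auto simp: coords_def inner_diff_left comb_inner C g_def)
    finally show ?thesis .
  qed
  have ha: "h (\<lambda>c\<in>C. y c + g x c) = (\<lambda>b\<in>B. h y b + x b)"
    if "x \<in> space (lborel_Pi B)" for x y
  proof -
    have "h (\<lambda>c\<in>C. y c + g x c) = coords B (T' (comb C y) + comb B x)"
      by (simp add: h_def comb_add comb_g linear_add[OF T'(1)] T'(3) comb_in_span)
    also have "\<dots> = (\<lambda>b\<in>B. h y b + x b)"
      by (auto simp: coords_def inner_add_left comb_inner B h_def)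
    finally show ?thesis .
  qed
  let ?A = "PiE B (\<lambda>_. {0..1::real})" and ?E = "PiE C (\<lambda>_. {0..1::real})"
  define k where "k = emeasure (lborel_Pi C) ((\<lambda>y. \<lambda>b\<in>B. - h y b) -` ?A \<inter> space (lborel_Pi C))"
  have A: "?A \<in> sets (lborel_Pi B)" and E: "?E \<in> sets (lborel_Pi C)"
    using fin by (auto intro!: sets_PiM_I_finite)
  have main: "emeasure (lborel_Pi C) D = k * emeasure (lborel_Pi B) (g -` D \<inter> space (lborel_Pi B))"
    if "D \<in> sets (lborel_Pi C)" for D
    using haar_exchange[OF fin g h gd ha A that] fin
    by (simp add: emeasure_unit_cube_lborel_Pi k_def mult.commute)
  have one: "k * emeasure (lborel_Pi B) (g -` ?E \<inter> space (lborel_Pi B)) = 1"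
    using main[OF E] by (simp add: emeasure_unit_cube_lborel_Pi fin)
  \<comment> \<open>The unit cube in the target has measure \<open>1\<close>, which excludes the constants \<open>0\<close> and \<open>\<infinity>\<close>.\<close>
  then have "k \<noteq> 0" by auto
  moreover have "k \<noteq> top"
    using one by (auto simp: ennreal_top_mult split: if_splits)
  ultimately obtain r where r: "k = ennreal r" "0 < r"
    by (cases k) (auto simp: less_le)
  have img: "g ` S = h -` S \<inter> space (lborel_Pi C)"
    and pre: "g -` g ` S \<inter> space (lborel_Pi B) = S" if "S \<in> sets (lborel_Pi B)" for S
  proof -
    have S: "S \<subseteq> space (lborel_Pi B)" using that by (rule sets.sets_into_space)
    have gx: "g x \<in> space (lborel_Pi C)" for x
      by (simp add: g_def space_lborel_Pi coords_in)
    show "g ` S = h -` S \<inter> space (lborel_Pi C)"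
    proof (intro equalityI subsetI)
      fix y assume "y \<in> g ` S"
      then obtain x where "x \<in> S" "y = g x" by blast
      then show "y \<in> h -` S \<inter> space (lborel_Pi C)" using hg[of x] gx S by auto
    next
      fix y assume "y \<in> h -` S \<inter> space (lborel_Pi C)"
      then show "y \<in> g ` S" using gh[of y] by (metis IntD1 IntD2 image_eqI vimageD)
    qed
    show "g -` g ` S \<inter> space (lborel_Pi B) = S"
    proof (intro equalityI subsetI)
      fix x assume "x \<in> g -` g ` S \<inter> space (lborel_Pi B)"
      then obtain x' where "x' \<in> S" "g x = g x'" "x \<in> space (lborel_Pi B)" by auto
      then show "x \<in> S" using hg[of x] hg[of x'] S by auto
    qed (use S in auto)
  qed
  have gS: "g ` S \<in> sets (lborel_Pi C)" if "S \<in> sets (lborel_Pi B)" for S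
    unfolding img[OF that] using h that by (rule measurable_sets)
  have gm: "emeasure (lborel_Pi C) (g ` S) = k * emeasure (lborel_Pi B) S" if "S \<in> sets (lborel_Pi B)" for S
    using main[OF gS[OF that]] pre[OF that] by simp
  have "scales_volume T (leb B) (leb C) r"
    unfolding scales_volume_def
  proof (intro conjI ballI)
    fix S assume S: "S \<in> sets (leb B)"
    then have S': "S \<subseteq> span B" "coords B ` S \<in> sets (completion (lborel_Pi B))"
      using sets_leb[OF B] by auto
    have "g (coords B x) = coords C (T x)" if "x \<in> S" for x
      using that S'(1) by (simp add: g_def comb_coords B subset_iff)
    then have co: "coords C ` T ` S = g ` coords B ` S"
      by (simp add: image_image)
    have sp: "T ` S \<subseteq> span C" using S'(1) T(3) by blast
    note im = image_completion[of "lborel_Pi B" g "lborel_Pi C" k, OF gS gm S'(2)]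
    show *: "T ` S \<in> sets (leb C)"
      unfolding sets_leb[OF C] co using sp im(1) by blast
    show "emeasure (leb C) (T ` S) = ennreal r * emeasure (leb B) S"
      using im(2)
      unfolding emeasure_leb[OF C *] emeasure_leb[OF B S] co r(1) .
  qed (use r in simp)
  with r(2) show ?thesis by (rule that)
qed

text \<open>An isometry fixes the unit ball, whose volume is positive and finite.\<close>
lemma isometry_scales_leb:
  assumes B: "orthonormal B" and T: "linear T" "T ` span B = span B" "\<And>x. x \<in> span B \<Longrightarrow> norm (T x) = norm x"
  shows "scales_volume T (leb B) (leb B) 1"
proof -
  have fin: "finite B" using B by (rule orthonormal_finite)
  have inj: "inj_on T (span B)"
  proof (rule inj_onI)
    fix x y assume xy: "x \<in> span B" "y \<in> span B" "T x = T y"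
    then have "norm (T (x - y)) = 0" by (simp add: linear_diff[OF T(1)])
    with xy T(3)[of "x - y"] show "x = y" by (simp add: span_diff)
  qed
  obtain k where k: "0 < k" "scales_volume T (leb B) (leb B) k"
    using linear_scales_leb[OF B B T(1) inj T(2)] by blast
  define A where "A = {x \<in> space (lborel_Pi B). (\<Sum>b\<in>B. (x b)\<^sup>2) \<le> 1}"
  have A: "A \<in> sets (lborel_Pi B)"
    unfolding A_def by measurable
  have ball: "comb B ` A = {v \<in> span B. norm v \<le> 1}"
  proof (intro equalityI subsetI)
    fix v assume "v \<in> comb B ` A"
    then obtain x where x: "x \<in> A" "v = comb B x" by auto
    then have "(norm v)\<^sup>2 \<le> 1"
      by (simp add: norm_eq_coords[OF B comb_in_span] comb_inner B A_def)
    then have "norm v \<le> 1" by (simp add: power_le_one_iff abs_square_le_1)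
    with x show "v \<in> {v \<in> span B. norm v \<le> 1}" by (simp add: comb_in_span)
  next
    fix v assume "v \<in> {v \<in> span B. norm v \<le> 1}"
    then have v: "v \<in> span B" "(norm v)\<^sup>2 \<le> 1" by (auto simp: power_le_one)
    then have "coords B v \<in> A"
      using coords_in[of B v] by (simp add: A_def space_lborel_Pi norm_eq_coords[OF B v(1)] coords_def)
    then show "v \<in> comb B ` A"
      using comb_coords[OF B v(1)] by (metis image_eqI)
  qed
  have "T ` {v \<in> span B. norm v \<le> 1} = {v \<in> span B. norm v \<le> 1}"
  proof (intro equalityI subsetI)
    fix v assume v: "v \<in> {v \<in> span B. norm v \<le> 1}"
    then obtain x where "x \<in> span B" "v = T x" using T(2) by blast
    with v T(3)[of x] show "v \<in> T ` {v \<in> span B. norm v \<le> 1}" by auto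
  qed (use T(2,3) in auto)
  then have TA: "T ` comb B ` A = comb B ` A" by (simp add: ball)
  have eq: "emeasure (lborel_Pi B) A = ennreal k * emeasure (lborel_Pi B) A"
    using k(2) leb_comb_image[OF B A] TA unfolding scales_volume_def by metis
  have "A \<subseteq> PiE B (\<lambda>_. {-1..1})"
  proof
    fix x assume x: "x \<in> A"
    have "\<bar>x b\<bar> \<le> 1" if "b \<in> B" for b
    proof -
      have "(x b)\<^sup>2 \<le> (\<Sum>b\<in>B. (x b)\<^sup>2)"
        using that fin by (intro member_le_sum) auto
      also have "\<dots> \<le> 1" using x by (simp add: A_def)
      finally show ?thesis by (simp add: abs_square_le_1)
    qed
    with x show "x \<in> PiE B (\<lambda>_. {-1..1})"
      by (auto simp: A_def space_lborel_Pi PiE_iff abs_le_iff)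
  qed
  then have "emeasure (lborel_Pi B) A \<le> emeasure (lborel_Pi B) (PiE B (\<lambda>_. {-1..1}))"
    using fin by (intro emeasure_mono) (auto intro!: sets_PiM_I_finite)
  also have "\<dots> < top" using emeasure_cube_lborel_Pi[OF fin, of 1] by simp
  finally have ltop: "emeasure (lborel_Pi B) A < top" .
  \<comment> \<open>The ball contains a cube small enough that the sum of the squared coordinates is at most \<open>1\<close>.\<close>
  define d where "d = 1 / (1 + real (card B))"
  have d: "0 < d" "real (card B) * d \<le> 1" "d \<le> 1" by (auto simp: d_def field_simps)
  have "PiE B (\<lambda>_. {-d..d}) \<subseteq> A"
  proof
    fix x assume x: "x \<in> PiE B (\<lambda>_. {-d..d})"
    have "(x b)\<^sup>2 \<le> d" if "b \<in> B" for b
    proof -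
      have "\<bar>x b\<bar> \<le> d" using x that by (force simp: PiE_iff)
      then have "(x b)\<^sup>2 \<le> d\<^sup>2" by (metis abs_ge_zero power2_abs power_mono)
      also have "\<dots> \<le> d" using d by (simp add: power2_eq_square mult_left_le)
      finally show ?thesis .
    qed
    then have "(\<Sum>b\<in>B. (x b)\<^sup>2) \<le> real (card B) * d"
      by (rule sum_bounded_above)
    with d x show "x \<in> A" by (auto simp: A_def space_lborel_Pi PiE_iff)
  qed
  then have "emeasure (lborel_Pi B) (PiE B (\<lambda>_. {-d..d})) \<le> emeasure (lborel_Pi B) A"
    using A by (rule emeasure_mono)
  moreover have "0 < (2 * d) ^ card B" using d by simp
  ultimately have "emeasure (lborel_Pi B) A \<noteq> 0"
    using emeasure_cube_lborel_Pi[OF fin, of d] d(1)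
    by (metis ennreal_eq_0_iff le_zero_eq less_eq_real_def not_less)
  then obtain r where "emeasure (lborel_Pi B) A = ennreal r" "0 < r"
    using ltop by (cases "emeasure (lborel_Pi B) A") (auto simp: less_le)
  with eq k(1) have "k = 1"
    by (simp add: ennreal_mult[symmetric] ennreal_inj)
  with k(2) show ?thesis by simp
qed

text \<open>
  The linear map \<open>T\<close> taking \<open>B\<close> to \<open>C\<close> has constant \<open>1\<close> from \<open>leb B\<close> to \<open>leb C\<close>, since it maps one
  unit cube to the other. Composed with the identity from \<open>leb C\<close> to \<open>leb B\<close> it becomes an isometry
  of \<open>span B\<close>, again with constant \<open>1\<close>. So the identity has constant \<open>1\<close> too.
\<close>
lemma scales_volume_id:
  assumes B: "orthonormal B" and C: "orthonormal C" and BC: "span B = span C"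
  shows "scales_volume (\<lambda>x. x) (leb C) (leb B) 1"
proof -
  note fin = orthonormal_finite[OF B] orthonormal_finite[OF C]
  have "card B = card C"
    using dim_span_orthonormal[OF B] dim_span_orthonormal[OF C] BC by simp
  then obtain \<phi> where \<phi>: "bij_betw \<phi> B C"
    using fin finite_same_card_bij by blast
  define \<psi> where "\<psi> = the_inv_into B \<phi>"
  have \<psi>: "\<psi> c \<in> B" "\<phi> (\<psi> c) = c" if "c \<in> C" for c
    using \<phi> that unfolding \<psi>_def bij_betw_def
    by (auto intro: the_inv_into_into f_the_inv_into_f)
  have \<psi>\<phi>: "\<psi> (\<phi> b) = b" if "b \<in> B" for b
    using \<phi> that unfolding \<psi>_def bij_betw_def by (auto intro: the_inv_into_f_f)
  have \<phi>C: "\<phi> b \<in> C" if "b \<in> B" for b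
    using \<phi> that by (auto simp: bij_betw_def)
  define T where "T v = (\<Sum>b\<in>B. inner v b *\<^sub>R \<phi> b)" for v
  have T_lin: "linear T"
    unfolding T_def
    by (rule linearI) (simp_all add: inner_add_left scaleR_left_distrib sum.distrib scaleR_sum_right)
  have T_comb: "T (comb B x) = comb C (\<lambda>c\<in>C. x (\<psi> c))" for x
  proof -
    have "T (comb B x) = (\<Sum>b\<in>B. x b *\<^sub>R \<phi> b)"
      by (simp add: T_def comb_inner B)
    also have "\<dots> = (\<Sum>b\<in>B. (\<lambda>c. x (\<psi> c) *\<^sub>R c) (\<phi> b))"
      by (simp add: \<psi>\<phi>)
    also have "\<dots> = (\<Sum>c\<in>C. x (\<psi> c) *\<^sub>R c)"
      by (rule sum.reindex_bij_betw[OF \<phi>])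
    finally show ?thesis by (simp add: comb_def)
  qed
  have T_inner: "inner (T v) (\<phi> b) = inner v b" if "v \<in> span B" "b \<in> B" for v b
  proof -
    have "T v = comb C (\<lambda>c\<in>C. coords B v (\<psi> c))"
      using T_comb[of "coords B v"] comb_coords[OF B that(1)] by simp
    then show ?thesis
      using that by (simp add: comb_inner C \<phi>C \<psi>\<phi> coords_def)
  qed
  have T_span: "T v \<in> span C" for v
    unfolding T_def by (intro span_sum span_scale span_base \<phi>C)
  have T_norm: "norm (T v) = norm v" if "v \<in> span B" for v
  proof -
    have "(norm (T v))\<^sup>2 = (\<Sum>c\<in>C. (inner (T v) c)\<^sup>2)"
      by (rule norm_eq_coords[OF C T_span])
    also have "\<dots> = (\<Sum>b\<in>B. (inner (T v) (\<phi> b))\<^sup>2)"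
      by (rule sum.reindex_bij_betw[OF \<phi>, symmetric])
    also have "\<dots> = (norm v)\<^sup>2"
      by (simp add: T_inner that norm_eq_coords[OF B that])
    finally show ?thesis by simp
  qed
  have T_image: "T ` span B = span C"
  proof (intro equalityI subsetI)
    fix y assume y: "y \<in> span C"
    have "T (comb B (\<lambda>b. inner y (\<phi> b))) = comb C (coords C y)"
      unfolding T_comb by (simp add: coords_def comb_def \<psi>)
    then show "y \<in> T ` span B"
      using comb_coords[OF C y] comb_in_span[of B] by (metis image_eqI)
  qed (use T_span in auto)
  have T_inj: "inj_on T (span B)"
  proof (rule inj_onI)
    fix x y assume xy: "x \<in> span B" "y \<in> span B" "T x = T y"
    then have "norm (T (x - y)) = 0" by (simp add: linear_diff[OF T_lin])
    with xy T_norm[of "x - y"] show "x = y" by (simp add: span_diff)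
  qed
  obtain k where k: "0 < k" "scales_volume T (leb B) (leb C) k"
    using linear_scales_leb[OF B C T_lin T_inj T_image] by blast
  have "T ` cube B = cube C"
  proof (intro equalityI subsetI)
    fix y assume "y \<in> T ` cube B"
    then obtain x where "x \<in> PiE B (\<lambda>_. {0..1})" "y = T (comb B x)" by (auto simp: cube_def)
    then have "y = comb C (\<lambda>c\<in>C. x (\<psi> c))" "(\<lambda>c\<in>C. x (\<psi> c)) \<in> PiE C (\<lambda>_. {0..1})"
      using \<psi> by (auto simp: T_comb PiE_iff)
    then show "y \<in> cube C" by (simp add: cube_def)
  next
    fix y assume "y \<in> cube C"
    then obtain x where x: "x \<in> PiE C (\<lambda>_. {0..1})" "y = comb C x" by (auto simp: cube_def)
    have "T (comb B (\<lambda>b\<in>B. x (\<phi> b))) = y"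
      unfolding T_comb x(2) by (simp add: comb_def \<psi>)
    moreover have "(\<lambda>b\<in>B. x (\<phi> b)) \<in> PiE B (\<lambda>_. {0..1})"
      using x \<phi>C by (auto simp: PiE_iff)
    ultimately show "y \<in> T ` cube B" by (auto simp: cube_def)
  qed
  then have "k = 1"
    using scales_volume_leb_factor[OF B k(2)] cube_leb[OF C] k(1) by simp
  obtain k' where k': "0 < k'" "scales_volume (\<lambda>x. x) (leb C) (leb B) k'"
    using linear_scales_leb[OF C B, of "\<lambda>x. x"] BC by (auto simp: linear_iff)
  have "scales_volume T (leb B) (leb B) k'"
    using scales_volume_compose[OF k(2) k'(2)] by (simp add: \<open>k = 1\<close>)
  moreover have "scales_volume T (leb B) (leb B) 1"
    by (rule isometry_scales_leb[OF B T_lin]) (use T_image BC T_norm in auto)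
  ultimately have "ennreal k' = ennreal 1"
    using scales_volume_leb_factor[OF B] by metis
  then have "k' = 1" using k'(1) by (simp add: ennreal_eq_1)
  with k'(2) show ?thesis by simp
qed

lemma leb_cong:
  assumes "orthonormal B" "orthonormal C" "span B = span C"
  shows "leb B = leb C"
proof (rule measure_eqI)
  note * = scales_volume_id[OF assms] scales_volume_id[OF assms(2,1) assms(3)[symmetric]]
  show "sets (leb B) = sets (leb C)"
    using * by (auto simp: scales_volume_def)
  show "emeasure (leb B) A = emeasure (leb C) A" if "A \<in> sets (leb B)" for A
    using *(2) that by (simp add: scales_volume_def)
qed

proposition lebesgue_of_eq_leb:
  assumes "orthonormal B"
  shows "lebesgue_of (span B) = leb B"
proof -
  define C where "C = (SOME C. orthonormal_basis_of (span B) C)"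
  have "orthonormal_basis_of (span B) C"
    unfolding C_def
    by (rule someI[where P = "orthonormal_basis_of (span B)" and x = B])
      (simp add: orthonormal_basis_of_iff assms)
  then have C: "orthonormal C" "span C = span B" by (auto simp: orthonormal_basis_of_iff)
  have "lebesgue_of (span B) = leb C"
    by (simp add: lebesgue_of_def leb_def Let_def C_def comb_def[abs_def])
  also have "\<dots> = leb B" by (rule leb_cong[OF C(1) assms C(2)])
  finally show ?thesis .
qed


section \<open>Extending a linear map by orthogonal directions\<close>

lemma mem_cube:
  assumes "orthonormal B"
  shows "v \<in> cube B \<longleftrightarrow> v \<in> span B \<and> (\<forall>b\<in>B. inner v b \<in> {0..1})"
proof
  assume "v \<in> cube B"
  then show "v \<in> span B \<and> (\<forall>b\<in>B. inner v b \<in> {0..1})"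
    by (auto simp: cube_def comb_in_span comb_inner assms PiE_iff)
next
  assume v: "v \<in> span B \<and> (\<forall>b\<in>B. inner v b \<in> {0..1})"
  then have "coords B v \<in> PiE B (\<lambda>_. {0..1})"
    by (auto simp: coords_def)
  with v show "v \<in> cube B"
    unfolding cube_def using comb_coords[OF assms, of v] by (metis image_eqI)
qed

text \<open>
  The coordinates in \<open>C\<close> of the image of \<open>cube B\<close> under a linear bijection of \<open>span B\<close> onto \<open>span C\<close>,
  described by the inverse \<open>T'\<close> of that bijection.
\<close>
definition image_cube :: "'a::real_inner set \<Rightarrow> 'b::real_inner set \<Rightarrow> ('b \<Rightarrow> 'a) \<Rightarrow> ('b \<Rightarrow> real) set" where
  "image_cube B C T' = {x \<in> space (lborel_Pi C). \<forall>b\<in>B. inner (T' (comb C x)) b \<in> {0..1}}"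

lemma image_cube_measurable:
  assumes "orthonormal B" "orthonormal C" "linear T'"
  shows "image_cube B C T' \<in> sets (lborel_Pi C)"
proof -
  have "image_cube B C T' = (\<lambda>x. coords B (T' (comb C x))) -` PiE B (\<lambda>_. {0..1}) \<inter> space (lborel_Pi C)"
    by (auto simp: image_cube_def coords_def PiE_iff)
  also have "\<dots> \<in> sets (lborel_Pi C)"
    using assms by (intro measurable_sets[OF measurable_coords_linear])
      (auto simp: orthonormal_finite intro!: sets_PiM_I_finite)
  finally show ?thesis .
qed

lemma emeasure_image_cube:
  assumes B: "orthonormal B" and C: "orthonormal C" and T': "linear T'" "\<And>x. x \<in> span B \<Longrightarrow> T' (T x) = x"
    and T: "T ` span B = span C"
    and k: "scales_volume T (leb B) (leb C) k"
  shows "emeasure (lborel_Pi C) (image_cube B C T') = ennreal k"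
proof -
  have "comb C ` image_cube B C T' = T ` cube B"
  proof (intro equalityI subsetI)
    fix y assume "y \<in> comb C ` image_cube B C T'"
    then obtain x where x: "x \<in> image_cube B C T'" "y = comb C x" by blast
    then obtain v where v: "v \<in> span B" "y = T v" using T comb_in_span[of C x] by blast
    then have "T' (comb C x) = v" by (simp add: x(2)[symmetric] T'(2))
    with x(1) v(1) have "v \<in> cube B" by (auto simp: mem_cube B image_cube_def)
    with v show "y \<in> T ` cube B" by blast
  next
    fix y assume "y \<in> T ` cube B"
    then obtain v where v: "v \<in> cube B" "y = T v" by blast
    then have "y \<in> span C" using T by (auto simp: mem_cube B)
    then have "comb C (coords C y) = y" by (rule comb_coords[OF C])
    moreover from this v have "coords C y \<in> image_cube B C T'"
      by (simp add: image_cube_def space_lborel_Pi coords_in T'(2) mem_cube B)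
    ultimately show "y \<in> comb C ` image_cube B C T'" by (metis image_eqI)
  qed
  then show ?thesis
    using leb_comb_image(2)[OF C image_cube_measurable[OF B C T'(1)]] scales_volume_leb_factor[OF B k] by simp
qed

text \<open>
  A linear bijection \<open>T\<close> of \<open>span B\<close> onto \<open>span C\<close> is extended by one dimension, in block triangular
  form with the entry \<open>s\<close> in the new diagonal position.
\<close>
context
  fixes T :: "'a::real_inner \<Rightarrow> 'b::real_inner" and B C u w and s :: real
  assumes B: "orthonormal (insert u B)" "u \<notin> B" and C: "orthonormal (insert w C)" "w \<notin> C"
    and T: "linear T" "inj_on T (span B)" "T ` span B = span C"
    and s: "T u - s *\<^sub>R w \<in> span C" "0 < s"
begin

lemma new_vector_orthogonal: "y \<in> span C \<Longrightarrow> inner w y = 0"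
  by (rule inner_span_zero) (use C in \<open>auto simp: orthonormal_insert\<close>)

lemma image_span_insert: "T ` span (insert u B) = span (insert w C)"
proof (intro equalityI subsetI)
  fix y assume "y \<in> T ` span (insert u B)"
  then obtain x t where x: "y = T x" "x - t *\<^sub>R u \<in> span B"
    by (auto simp: span_breakdown_eq)
  have "T (x - t *\<^sub>R u) + t *\<^sub>R (T u - s *\<^sub>R w) \<in> span C"
    using x(2) T(3) s(1) by (intro span_add span_scale) auto
  then have "y - (t * s) *\<^sub>R w \<in> span C"
    by (simp add: x linear_diff[OF T(1)] linear_scale[OF T(1)] algebra_simps)
  then show "y \<in> span (insert w C)" by (auto simp: span_breakdown_eq)
next
  fix y assume "y \<in> span (insert w C)"
  then obtain t where "y - t *\<^sub>R w \<in> span C" by (auto simp: span_breakdown_eq)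
  then have "(y - t *\<^sub>R w) - (t / s) *\<^sub>R (T u - s *\<^sub>R w) \<in> span C"
    by (rule span_diff[OF _ span_scale[OF s(1)]])
  then obtain z where z: "z \<in> span B" "T z = (y - t *\<^sub>R w) - (t / s) *\<^sub>R (T u - s *\<^sub>R w)"
    using T(3) by (metis imageE)
  have "T (z + (t / s) *\<^sub>R u) = y"
    using s(2) by (simp add: linear_add[OF T(1)] linear_scale[OF T(1)] z algebra_simps)
  moreover have "z + (t / s) *\<^sub>R u \<in> span (insert u B)"
    using z(1) by (auto simp: span_breakdown_eq intro!: exI[of _ "t / s"])
  ultimately show "y \<in> T ` span (insert u B)" by blast
qed

lemma inj_on_span_insert: "inj_on T (span (insert u B))"
proof -
  have "x = 0" if x: "x \<in> span (insert u B)" "T x = 0" for x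
  proof -
    obtain t where t: "x - t *\<^sub>R u \<in> span B" using x(1) by (auto simp: span_breakdown_eq)
    then have "T (x - t *\<^sub>R u) + t *\<^sub>R (T u - s *\<^sub>R w) \<in> span C"
      using T(3) s(1) by (intro span_add span_scale) auto
    then have "inner w (T (x - t *\<^sub>R u) + t *\<^sub>R (T u - s *\<^sub>R w)) = 0" by (rule new_vector_orthogonal)
    moreover have "T (x - t *\<^sub>R u) + t *\<^sub>R (T u - s *\<^sub>R w) = - (t * s) *\<^sub>R w"
      by (simp add: x linear_diff[OF T(1)] linear_scale[OF T(1)] algebra_simps)
    moreover have "inner w w = 1" using C by (simp add: orthonormal_inner)
    ultimately have "t = 0" using s(2) by simp
    with t x(2) T(2) show ?thesis
      using linear_0[OF T(1)] by (auto dest!: inj_onD[of T _ x 0] intro: span_zero)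
  qed
  then show ?thesis
    using linear_inj_on_iff_eq_0[OF T(1) subspace_span] by blast
qed

text \<open>
  Cavalieri's principle: the image of the cube over \<open>insert u B\<close> is sliced by the coordinate along
  \<open>w\<close>. The slice at height \<open>y \<in> {0..s}\<close> is a translate of the image of the cube over \<open>B\<close>, and the other
  slices are empty.
\<close>
lemma scales_leb_insert:
  assumes k: "scales_volume T (leb B) (leb C) k"
  shows "scales_volume T (leb (insert u B)) (leb (insert w C)) (s * k)"
proof -
  let ?B = "insert u B" and ?C = "insert w C"
  have B1: "orthonormal B" and C1: "orthonormal C"
    using B C by (auto simp: orthonormal_insert)
  note fin = orthonormal_finite[OF B1] orthonormal_finite[OF C1]
  obtain T' where T': "linear T'" "\<And>x. x \<in> span ?B \<Longrightarrow> T' (T x) = x"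
    using linear_inverse_on[OF T(1) subspace_span inj_on_span_insert image_span_insert] by metis
  have u: "u \<in> span ?B" by (simp add: span_base)
  have T'1: "T' (T x) = x" if "x \<in> span B" for x
    using that T'(2) span_mono[of B ?B] by auto
  have T'C: "T' y \<in> span B" if "y \<in> span C" for y
    using that T(3) T'1 by (metis imageE)
  obtain k' where k': "0 < k'" "scales_volume T (leb ?B) (leb ?C) k'"
    using linear_scales_leb[OF B(1) C(1) T(1) inj_on_span_insert image_span_insert] by metis
  let ?D = "image_cube ?B ?C T'" and ?D1 = "image_cube B C T'"
  have D: "?D \<in> sets (lborel_Pi ?C)" by (rule image_cube_measurable[OF B(1) C(1) T'(1)])
  have D1: "?D1 \<in> sets (lborel_Pi C)" by (rule image_cube_measurable[OF B1 C1 T'(1)])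
  \<comment> \<open>The slice at height \<open>y\<close> is translated by \<open>(y / s) *\<^sub>R w1\<close>; \<open>t y\<close> holds the negated coordinates.\<close>
  define w1 where "w1 = T u - s *\<^sub>R w"
  define t where "t y c = - (y / s) * inner w1 c" for y c
  have mem: "x(w := y) \<in> ?D \<longleftrightarrow> y \<in> {0..s} \<and> (\<lambda>c\<in>C. x c + t y c) \<in> ?D1"
    if x: "x \<in> space (lborel_Pi C)" for x y
  proof -
    have cC: "comb ?C (x(w := y)) = y *\<^sub>R w + comb C x"
      using C(2) fin by (auto simp: comb_def intro!: sum.cong)
    have "comb C (\<lambda>c\<in>C. x c + t y c) = comb C x + comb C (t y)"
      by (rule comb_add)
    also have "comb C (t y) = - (y / s) *\<^sub>R comb C (coords C w1)"
      by (simp add: comb_def t_def coords_def scaleR_sum_right)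
    also have "comb C (coords C w1) = w1"
      using s(1) by (simp add: comb_coords C1 w1_def)
    finally have c1: "comb C (\<lambda>c\<in>C. x c + t y c) = comb C x - (y / s) *\<^sub>R w1"
      by (simp only: scaleR_minus_left add_uminus_conv_diff)
    define v where "v = T' (comb C x - (y / s) *\<^sub>R w1)"
    have v: "v \<in> span B"
      unfolding v_def using s(1) by (intro T'C span_diff span_scale comb_in_span) (simp add: w1_def)
    have "comb ?C (x(w := y)) = (comb C x - (y / s) *\<^sub>R w1) + (y / s) *\<^sub>R T u"
      using s(2) by (simp add: cC w1_def algebra_simps)
    then have eq: "T' (comb ?C (x(w := y))) = v + (y / s) *\<^sub>R u"
      by (simp add: v_def linear_add[OF T'(1)] linear_scale[OF T'(1)] T'(2)[OF u])
    have ub: "inner u b = 0" if "b \<in> B" for b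
      using B that by (auto simp: orthonormal_insert)
    have "inner v u = 0"
      using inner_span_zero[of B u v] ub v by (simp add: inner_commute)
    moreover have "inner u u = 1" using B by (simp add: orthonormal_inner)
    moreover have "x(w := y) \<in> space (lborel_Pi ?C)"
      using x by (auto simp: space_lborel_Pi PiE_iff extensional_def)
    ultimately have "x(w := y) \<in> ?D \<longleftrightarrow> y / s \<in> {0..1} \<and> (\<forall>b\<in>B. inner v b \<in> {0..1})"
      unfolding image_cube_def by (simp add: eq inner_add_left ub del: fun_upd_apply)
    also have "y / s \<in> {0..1} \<longleftrightarrow> y \<in> {0..s}"
      using s(2) by (simp add: zero_le_divide_iff)
    also have "(\<forall>b\<in>B. inner v b \<in> {0..1}) \<longleftrightarrow> (\<lambda>c\<in>C. x c + t y c) \<in> ?D1"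
      unfolding image_cube_def by (simp add: c1 v_def space_lborel_Pi)
    finally show ?thesis .
  qed
  have D1_ind: "indicator ?D1 \<in> borel_measurable (lborel_Pi C)" using D1 by simp
  have "ennreal k' = emeasure (lborel_Pi ?C) ?D"
    using emeasure_image_cube[OF B(1) C(1) T' image_span_insert k'(2)] by simp
  also have "\<dots> = (\<integral>\<^sup>+x. indicator ?D x \<partial>lborel_Pi ?C)" using D by simp
  also have "\<dots> = (\<integral>\<^sup>+y. \<integral>\<^sup>+x. indicator ?D (x(w := y)) \<partial>lborel_Pi C \<partial>lborel)"
    using D by (intro lborel_product.product_nn_integral_insert_rev fin C) simp
  also have "\<dots> = (\<integral>\<^sup>+y. \<integral>\<^sup>+x. indicator {0..s} y * indicator ?D1 (\<lambda>c\<in>C. x c + t y c) \<partial>lborel_Pi C \<partial>lborel)"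
    by (intro nn_integral_cong) (simp add: indicator_def mem del: atLeastAtMost_iff)
  also have "\<dots> = (\<integral>\<^sup>+y. indicator {0..s} y * (\<integral>\<^sup>+x. indicator ?D1 (\<lambda>c\<in>C. x c + t y c) \<partial>lborel_Pi C) \<partial>lborel)"
    by (intro nn_integral_cong nn_integral_cmult measurable_compose[OF restrict_add_measurable D1_ind])
  also have "\<dots> = (\<integral>\<^sup>+y. indicator {0..s} y * ennreal k \<partial>lborel)"
    using emeasure_image_cube[OF B1 C1 T'(1) T'1 T(3) k] D1
    by (simp add: nn_integral_translate_lborel_Pi[OF fin(2) D1_ind])
  also have "\<dots> = ennreal s * ennreal k"
    using s(2) by (simp add: nn_integral_multc)
  finally have "ennreal k' = ennreal (s * k)"
    using k s(2) by (simp add: scales_volume_def ennreal_mult)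
  then have "k' = s * k"
    using k k'(1) s(2) by (simp add: scales_volume_def)
  with k'(2) show ?thesis by simp
qed

end

text \<open>
  The extension of a linear bijection by several dimensions, with the same diagonal entry \<open>s\<close> each time.
\<close>
lemma scales_leb_extend:
  fixes T :: "'a::real_inner \<Rightarrow> 'b::real_inner"
  assumes "finite F"
    and "orthonormal (B \<union> a ` F)" "inj_on a F" "a ` F \<inter> B = {}"
    and "orthonormal (C \<union> b ` F)" "inj_on b F" "b ` F \<inter> C = {}"
    and T: "linear T" "inj_on T (span B)" "T ` span B = span C"
    and s: "\<And>i. i \<in> F \<Longrightarrow> T (a i) - s *\<^sub>R b i \<in> span C" "0 < s"
    and k: "scales_volume T (leb B) (leb C) k"
  shows "T ` span (B \<union> a ` F) = span (C \<union> b ` F) \<and> inj_on T (span (B \<union> a ` F)) \<and>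
    scales_volume T (leb (B \<union> a ` F)) (leb (C \<union> b ` F)) (s ^ card F * k)"
  using assms(1-7) s(1)
proof (induction F rule: finite_induct)
  case empty
  with T k show ?case by simp
next
  case (insert i F)
  let ?B = "B \<union> a ` F" and ?C = "C \<union> b ` F"
  have eq: "B \<union> a ` insert i F = insert (a i) ?B" "C \<union> b ` insert i F = insert (b i) ?C" by auto
  have o: "orthonormal (insert (a i) ?B)" "orthonormal (insert (b i) ?C)"
    using insert.prems(1,4) by (simp_all only: eq)
  have n: "a i \<notin> ?B" "b i \<notin> ?C"
    using insert.prems insert.hyps by (auto simp: inj_on_def)
  have IH: "T ` span ?B = span ?C \<and> inj_on T (span ?B) \<and>
    scales_volume T (leb ?B) (leb ?C) (s ^ card F * k)"
    using o insert.prems by (intro insert.IH) (auto simp: orthonormal_insert)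
  have "T (a i) - s *\<^sub>R b i \<in> span ?C"
    using insert.prems(7)[of i] span_mono[of C ?C] by auto
  note * = o(1) n(1) o(2) n(2) T(1) conjunct1[OF conjunct2[OF IH]] conjunct1[OF IH] this s(2)
  show ?case
    using image_span_insert[OF *] inj_on_span_insert[OF *]
      scales_leb_insert[OF * conjunct2[OF conjunct2[OF IH]]] insert.hyps
    unfolding eq by (simp add: mult.assoc)
qed


section \<open>Projections on coordinate lines over the field\<close>

lemma orthonormal_Un:
  assumes "orthonormal A" "orthonormal B" "\<And>a b. a \<in> A \<Longrightarrow> b \<in> B \<Longrightarrow> inner a b = 0"
  shows "orthonormal (A \<union> B)" "A \<inter> B = {}"
proof -
  show "orthonormal (A \<union> B)"
    using assms by (auto simp: orthonormal_def pairwise_def orthogonal_def) (metis inner_commute)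
  show "A \<inter> B = {}"
  proof (rule ccontr)
    assume "A \<inter> B \<noteq> {}"
    then obtain x where "x \<in> A" "x \<in> B" by blast
    with assms(3)[of x x] orthonormal_norm[OF assms(1), of x] show False by auto
  qed
qed

lemma dim_subspace_le:
  assumes "orthonormal B" "subspace U" "U \<subseteq> span B"
  shows "dim U \<le> card B"
proof -
  obtain A where A: "orthonormal A" "span A = U"
    using orthonormal_basis_exists[OF orthonormal_finite[OF assms(1)] assms(2,3)] .
  then have "card A \<le> card B"
    using independent_span_bound[OF orthonormal_finite[OF assms(1)] orthonormal_independent[OF A(1)]]
      assms(3) span_superset[of A] by auto
  then show ?thesis using dim_span_orthonormal[OF A(1)] A(2) by simp
qed

lemma subspace_eq_if_dim_eq:
  assumes "orthonormal B" "subspace U" "U \<subseteq> span B" "dim U = card B"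
  shows "U = span B"
proof (rule ccontr)
  assume "U \<noteq> span B"
  then obtain x where x: "x \<in> span B" "x \<notin> U" using assms(3) by blast
  obtain A where A: "orthonormal A" "span A = U"
    using orthonormal_basis_exists[OF orthonormal_finite[OF assms(1)] assms(2,3)] .
  have "independent (insert x A)"
    using orthonormal_independent[OF A(1)] x(2) A(2) by (simp add: independent_insertI)
  moreover have "insert x A \<subseteq> span B"
    using x(1) A(2) assms(3) span_superset[of A] by auto
  ultimately have "card (insert x A) \<le> card B"
    using independent_span_bound[OF orthonormal_finite[OF assms(1)]] by blast
  moreover have "x \<notin> A" using x(2) A(2) span_superset[of A] by auto
  moreover have "card A = card B"
    using dim_span_orthonormal[OF A(1)] A(2) assms(4) by simp
  ultimately show False using orthonormal_finite[OF A(1)] by simp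
qed

lemma dim_inj_image:
  fixes T :: "'a::real_inner \<Rightarrow> 'b::real_inner"
  assumes "orthonormal B" "linear T" "inj_on T (span B)"
  shows "dim (T ` span B) = card B"
proof -
  have "independent (T ` B)"
    using assms orthonormal_independent by (intro linear_independent_injective_image) auto
  moreover have "card (T ` B) = card B"
    using assms(3) inj_on_subset[OF _ span_superset] by (intro card_image) blast
  ultimately show ?thesis
    using linear_span_image[OF assms(2), of B] by (metis dim_eq_card span_span)
qed

lemma inj_on_if_dim_eq:
  fixes T :: "'a::real_inner \<Rightarrow> 'b::real_inner"
  assumes B: "orthonormal B" and T: "linear T" "dim (T ` span B) = card B"
  shows "inj_on T (span B)"
proof -
  obtain g where g: "range g \<subseteq> span B" "linear g" "\<And>y. y \<in> T ` span B \<Longrightarrow> T (g y) = y"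
    using linear_exists_right_inverse_on[OF T(1) subspace_span, of B] by metis
  have sub: "subspace (T ` span B)" using linear_subspace_image[OF T(1)] by simp
  have "T ` span B \<subseteq> span (T ` B)" using linear_span_image[OF T(1), of B] by simp
  then obtain C where C: "orthonormal C" "span C = T ` span B"
    using orthonormal_basis_exists[OF _ sub] orthonormal_finite[OF B] by (metis finite_imageI)
  have "inj_on g (span C)"
    using g(3) C(2) by (metis inj_onI)
  then have "dim (g ` span C) = card C"
    by (rule dim_inj_image[OF C(1) g(2)])
  also have "\<dots> = card B" using dim_span_orthonormal[OF C(1)] C(2) T(2) by simp
  finally have "g ` span C = span B"
    using g(1) linear_subspace_image[OF g(2)] by (intro subspace_eq_if_dim_eq[OF B]) auto
  then have "g (T x) = x" if "x \<in> span B" for x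
    using that g(3) C(2) by (metis imageE)
  then show ?thesis by (metis inj_onI)
qed


text \<open>The multi-indices of length \<open>p\<close> with entries in an arbitrary set \<open>J\<close>.\<close>
definition idx :: "'i set \<Rightarrow> nat \<Rightarrow> 'i set set" where
  "idx J p = {I. I \<subseteq> J \<and> card I = p}"

lemma finite_idx: "finite J \<Longrightarrow> finite (idx J p)"
  by (auto simp: idx_def intro: finite_subset[of _ "Pow J"])

lemma idx_insert_Suc:
  assumes "finite J" "j \<notin> J"
  shows "idx (insert j J) (Suc p) = idx J (Suc p) \<union> insert j ` idx J p"
proof (intro equalityI subsetI)
  fix I assume I: "I \<in> idx (insert j J) (Suc p)"
  show "I \<in> idx J (Suc p) \<union> insert j ` idx J p"
  proof (cases "j \<in> I")
    case True
    with I have "I - {j} \<in> idx J p" "I = insert j (I - {j})" by (auto simp: idx_def)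
    then show ?thesis by blast
  qed (use I in \<open>auto simp: idx_def\<close>)
next
  fix I assume I: "I \<in> idx J (Suc p) \<union> insert j ` idx J p"
  have "card (insert j L) = Suc p" if "L \<subseteq> J" "card L = p" for L
    using that assms by (metis card_insert_disjoint finite_subset subsetD)
  with I show "I \<in> idx (insert j J) (Suc p)" by (auto simp: idx_def)
qed

lemma sum_idx_insert_Suc:
  assumes "finite J" "j \<notin> J"
  shows "(\<Sum>I\<in>idx (insert j J) (Suc p). f I) = (\<Sum>I\<in>idx J (Suc p). f I) + (\<Sum>L\<in>idx J p. f (insert j L))"
proof -
  have "inj_on (insert j) (idx J p)"
    using assms(2) by (auto simp: idx_def inj_on_def insert_ident)
  moreover have "idx J (Suc p) \<inter> insert j ` idx J p = {}"
    using assms(2) by (auto simp: idx_def)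
  ultimately show ?thesis
    using finite_idx[OF assms(1)] by (simp add: idx_insert_Suc[OF assms] sum.union_disjoint sum.reindex)
qed

lemma idx_insert_0: "finite J \<Longrightarrow> idx (insert j J) 0 = idx J 0"
  by (auto simp: idx_def finite_subset dest!: finite_subset)


text \<open>
  The scalar field, seen through a finite family \<open>act k\<close> of real linear isometries that contains the
  identity and represents an orthonormal real basis of the field: only the identity over the reals,
  the identity and multiplication by \<open>\<i>\<close> over the complex numbers. The last assumption says that a
  vector orthogonal to the line of \<open>y\<close> has its whole line orthogonal to it. The family is indexed,
  since in the zero space its members coincide.
\<close>
locale line_structure =
  fixes K :: "'k set" and act :: "'k \<Rightarrow> 'a::real_inner \<Rightarrow> 'a"
  assumes finite_K: "finite K"
    and act_one: "\<exists>k\<in>K. \<forall>x. act k x = x"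
    and act_linear: "k \<in> K \<Longrightarrow> linear (act k)"
    and act_norm: "k \<in> K \<Longrightarrow> norm (act k x) = norm x"
    and act_orth: "k \<in> K \<Longrightarrow> l \<in> K \<Longrightarrow> k \<noteq> l \<Longrightarrow> inner (act k x) (act l x) = 0"
    and act_closed: "k \<in> K \<Longrightarrow> l \<in> K \<Longrightarrow> act k (act l x) \<in> span ((\<lambda>m. act m x) ` K)"
    and act_perp: "(\<And>l. l \<in> K \<Longrightarrow> inner x (act l y) = 0) \<Longrightarrow> k \<in> K \<Longrightarrow> m \<in> K \<Longrightarrow>
      inner (act k x) (act m y) = 0"
begin

text \<open>The real dimension of the field.\<close>
definition d :: nat where "d = card K"

lemma d_pos: "0 < d"
  using finite_K act_one by (auto simp: d_def card_gt_0_iff)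

text \<open>
  The orbit of a unit vector is an orthonormal real basis of the line through it. For a
  family \<open>e\<close> that is orthonormal over the field, \<open>lines e I\<close> is an orthonormal real basis of the
  coordinate subspace with multi-index \<open>I\<close>.
\<close>
definition orbit :: "'a \<Rightarrow> 'a set" where
  "orbit x = (\<lambda>k. act k x) ` K"

definition lines :: "('i \<Rightarrow> 'a) \<Rightarrow> 'i set \<Rightarrow> 'a set" where
  "lines e I = (\<Union>i\<in>I. orbit (e i))"

text \<open>Subspaces over the field, as real subspaces stable under its action.\<close>
definition invariant :: "'a set \<Rightarrow> bool" where
  "invariant V \<longleftrightarrow> subspace V \<and> (\<forall>k\<in>K. \<forall>x\<in>V. act k x \<in> V)"

text \<open>A finite family that is orthonormal over the field.\<close>
definition frame :: "('i \<Rightarrow> 'a) \<Rightarrow> 'i set \<Rightarrow> bool" where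
  "frame e J \<longleftrightarrow> finite J \<and> (\<forall>i\<in>J. norm (e i) = 1) \<and>
     (\<forall>i\<in>J. \<forall>j\<in>J. i \<noteq> j \<longrightarrow> (\<forall>k\<in>K. inner (e i) (act k (e j)) = 0))"

lemma self_in_orbit: "x \<in> orbit x"
  using act_one unfolding orbit_def by (metis image_eqI)

lemma act_perp1:
  assumes "\<And>l. l \<in> K \<Longrightarrow> inner x (act l y) = 0" "k \<in> K"
  shows "inner (act k x) y = 0"
  using act_perp[of x y k, OF assms] act_one by metis

lemma inj_act: "norm x = 1 \<Longrightarrow> inj_on (\<lambda>k. act k x) K"
proof (rule inj_onI, rule ccontr)
  fix k l assume x: "norm x = 1" and kl: "k \<in> K" "l \<in> K" "act k x = act l x" "k \<noteq> l"
  with act_orth[of k l x] have "norm (act k x) = 0" by simp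
  with x kl act_norm[of k x] show False by simp
qed

lemma orthonormal_orbit: "norm x = 1 \<Longrightarrow> orthonormal (orbit x)"
  using finite_K act_orth act_norm by (auto simp: orthonormal_def orbit_def pairwise_def orthogonal_def)

lemma card_orbit: "norm x = 1 \<Longrightarrow> card (orbit x) = d"
  unfolding orbit_def d_def by (intro card_image inj_act)

lemma orbit_scale: "orbit (r *\<^sub>R x) = (\<lambda>y. r *\<^sub>R y) ` orbit x"
  using linear_scale[OF act_linear] by (auto simp: orbit_def image_image)

lemma span_orbit_scale: "r \<noteq> 0 \<Longrightarrow> span (orbit (r *\<^sub>R x)) = span (orbit x)"
  unfolding orbit_scale by (intro span_image_scale) (auto simp: orbit_def finite_K)

lemma invariant_span:
  assumes "\<And>x k. x \<in> A \<Longrightarrow> k \<in> K \<Longrightarrow> act k x \<in> span A"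
  shows "invariant (span A)"
proof -
  have "act k x \<in> span A" if "x \<in> span A" "k \<in> K" for x k
  proof -
    have "act k x \<in> act k ` span A" using that by blast
    also have "\<dots> = span (act k ` A)" using linear_span_image[OF act_linear[OF that(2)]] by simp
    also have "\<dots> \<subseteq> span A" using assms that(2) by (intro span_minimal) auto
    finally show ?thesis .
  qed
  then show ?thesis by (simp add: invariant_def)
qed

lemma act_orbit: "y \<in> orbit x \<Longrightarrow> k \<in> K \<Longrightarrow> act k y \<in> span (orbit x)"
  using act_closed unfolding orbit_def by auto

lemma invariant_lines: "invariant (span (lines e I))"
proof (rule invariant_span)
  fix x k assume "x \<in> lines e I" "k \<in> K"
  then obtain i where "i \<in> I" "x \<in> orbit (e i)" by (auto simp: lines_def)
  with \<open>k \<in> K\<close> act_orbit[of x "e i" k] span_mono[of "orbit (e i)" "lines e I"]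
  show "act k x \<in> span (lines e I)" by (auto simp: lines_def)
qed

lemma orbit_subset: "invariant V \<Longrightarrow> x \<in> V \<Longrightarrow> orbit x \<subseteq> V"
  by (auto simp: invariant_def orbit_def)

lemma lines_insert: "lines e (insert j I) = lines e I \<union> orbit (e j)"
  by (auto simp: lines_def)

lemma lines_mono: "I \<subseteq> J \<Longrightarrow> lines e I \<subseteq> lines e J"
  by (auto simp: lines_def)

lemma lines_singleton: "lines e {j} = orbit (e j)"
  by (simp add: lines_def)

lemma frame_subset: "frame e J \<Longrightarrow> I \<subseteq> J \<Longrightarrow> frame e I"
  unfolding frame_def by (meson finite_subset subsetD)

lemma frame_orbits_orth:
  assumes "frame e J" "i \<in> J" "j \<in> J" "i \<noteq> j" "x \<in> orbit (e i)" "y \<in> orbit (e j)"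
  shows "inner x y = 0"
  using assms act_perp[of "e i" "e j"] unfolding frame_def orbit_def by auto

lemma frame_lines:
  assumes "frame e J"
  shows "orthonormal (lines e J)" "card (lines e J) = d * card J"
proof -
  have "finite J" using assms by (simp add: frame_def)
  then have "orthonormal (lines e J) \<and> card (lines e J) = d * card J"
    using assms
  proof (induction J rule: finite_induct)
    case empty
    then show ?case by (simp add: lines_def orthonormal_def)
  next
    case (insert j J)
    have IH: "orthonormal (lines e J)" "card (lines e J) = d * card J"
      using insert frame_subset by blast+
    have j: "norm (e j) = 1" using insert.prems by (simp add: frame_def)
    have "inner a b = 0" if "a \<in> lines e J" "b \<in> orbit (e j)" for a b
      using that frame_orbits_orth[OF insert.prems, of _ j a b] insert.hyps(2) by (auto simp: lines_def)
    note un = orthonormal_Un[OF IH(1) orthonormal_orbit[OF j] this]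
    show ?case
      using un IH(2) insert.hyps card_orbit[OF j]
        card_Un_disjoint[OF orthonormal_finite[OF IH(1)] orthonormal_finite[OF orthonormal_orbit[OF j]] un(2)]
      by (simp add: lines_insert)
  qed
  then show "orthonormal (lines e J)" "card (lines e J) = d * card J" by auto
qed

lemma lines_orth:
  assumes "frame e (insert j J)" "j \<notin> J" "x \<in> span (lines e J)" "y \<in> span (orbit (e j))"
  shows "inner x y = 0"
proof -
  have "inner a b = 0" if "a \<in> lines e J" "b \<in> orbit (e j)" for a b
    using that frame_orbits_orth[OF assms(1), of _ j a b] assms(2) by (auto simp: lines_def)
  then have "inner y a = 0" if "a \<in> lines e J" for a
    using inner_span_zero[of "orbit (e j)" a y] assms(4) that by (metis inner_commute)
  then show ?thesis
    using inner_span_zero[of "lines e J" y x] assms(3) by (simp add: inner_commute)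
qed

lemma proj_lines_act:
  assumes "frame e I" "k \<in> K"
  shows "proj (lines e I) (act k x) = act k (proj (lines e I) x)"
proof (rule proj_unique[OF frame_lines(1)[OF assms(1)]])
  show "act k (proj (lines e I) x) \<in> span (lines e I)"
    using invariant_lines proj_in_span assms(2) by (metis invariant_def)
next
  fix b assume "b \<in> lines e I"
  then obtain i m where i: "i \<in> I" "m \<in> K" "b = act m (e i)" by (auto simp: lines_def orbit_def)
  have "inner (act k (x - proj (lines e I) x)) b = 0"
    unfolding i(3)
  proof (rule act_perp[OF _ assms(2) i(2)])
    fix l assume "l \<in> K"
    then have "act l (e i) \<in> lines e I" using i(1) by (auto simp: lines_def orbit_def)
    then show "inner (x - proj (lines e I) x) (act l (e i)) = 0"
      by (intro proj_residual[OF frame_lines(1)[OF assms(1)]] span_base)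
  qed
  then show "inner (act k x - act k (proj (lines e I) x)) b = 0"
    by (simp add: linear_diff[OF act_linear[OF assms(2)]])
qed

lemma proj_lines_insert:
  assumes "frame e (insert j I)" "j \<notin> I"
  shows "proj (lines e (insert j I)) x = proj (lines e I) x + proj (orbit (e j)) x"
proof -
  have 1: "orthonormal (lines e I)" using frame_lines(1) frame_subset[OF assms(1)] by blast
  have 2: "orthonormal (orbit (e j))" using assms(1) by (intro orthonormal_orbit) (simp add: frame_def)
  have "lines e I \<inter> orbit (e j) = {}"
    by (rule orthonormal_Un(2)[OF 1 2], rule lines_orth[OF assms]) (auto intro: span_base)
  then show ?thesis
    unfolding proj_def lines_insert using 1 2 by (intro sum.union_disjoint) (auto dest: orthonormal_finite)
qed

lemma proj_lines_proj:
  assumes "frame e J" "I \<subseteq> J"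
  shows "proj (lines e I) (proj (lines e J) x) = proj (lines e I) x"
  unfolding proj_def[of "lines e I"]
proof (intro sum.cong refl)
  fix b assume "b \<in> lines e I"
  then have "b \<in> lines e J" using lines_mono[OF assms(2)] by blast
  then have "inner (x - proj (lines e J) x) b = 0"
    by (intro proj_residual[OF frame_lines(1)[OF assms(1)]] span_base)
  then show "inner (proj (lines e J) x) b *\<^sub>R b = inner x b *\<^sub>R b"
    by (simp add: inner_diff_left)
qed

text \<open>
  The projection of \<open>V\<close> on the coordinate subspace with multi-index \<open>I\<close> scales the measure by \<open>s ^ d\<close>,
  as a map onto its image; \<open>s = 0\<close> marks the case of a projection that is not injective on \<open>V\<close>.
\<close>
definition proj_factor :: "('i \<Rightarrow> 'a) \<Rightarrow> 'a set \<Rightarrow> 'i set \<Rightarrow> real \<Rightarrow> bool" where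
  "proj_factor e V I s \<longleftrightarrow> 0 \<le> s \<and>
     (if inj_on (proj (lines e I)) V
      then scales_volume (proj (lines e I)) (lebesgue_of V) (lebesgue_of (proj (lines e I) ` V)) (s ^ d)
      else s = 0)"

end


section \<open>The Pythagorean relation\<close>

context line_structure
begin

lemma proj_factor_not_inj:
  assumes "x \<in> V" "x \<noteq> 0" "0 \<in> V" "proj (lines e I) x = 0"
  shows "proj_factor e V I 0"
proof -
  have "\<not> inj_on (proj (lines e I)) V"
    using assms inj_onD[of "proj (lines e I)" V x 0] linear_0[OF linear_proj] by metis
  then show ?thesis by (simp add: proj_factor_def)
qed

lemma not_inj_if_dim_less:
  assumes "frame e I" "orthonormal B" "span B = V" "proj (lines e L) ` V \<subseteq> span (lines e I)" "d * card I < card B"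
  shows "\<not> inj_on (proj (lines e L)) V"
proof
  assume inj: "inj_on (proj (lines e L)) V"
  have "dim (proj (lines e L) ` span B) = card B"
    by (rule dim_inj_image[OF assms(2) linear_proj]) (simp add: assms(3) inj)
  moreover have "dim (proj (lines e L) ` span B) \<le> card (lines e I)"
    using assms(3,4) by (intro dim_subspace_le frame_lines(1)[OF assms(1)] linear_subspace_image linear_proj subspace_span) auto
  ultimately show False using frame_lines(2)[OF assms(1)] assms(5) by simp
qed

text \<open>
  The Pythagorean relation for the scaling factors, by induction on the number of coordinate lines.
  The new line is that of \<open>e j\<close>, and \<open>?H\<close> is the span of the old ones.
\<close>
lemma sum_proj_factor:
  fixes e :: "'i \<Rightarrow> 'a"
  assumes "finite J" "frame e J" "invariant V" "V \<subseteq> span (lines e J)" "dim V = d * p"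
  shows "\<exists>s. (\<forall>I\<in>idx J p. proj_factor e V I (s I)) \<and> (\<Sum>I\<in>idx J p. (s I)\<^sup>2) = 1"
  using assms
proof (induction J arbitrary: V p rule: finite_induct)
  case empty
  have "V = span {}" using empty.prems by (auto simp: lines_def invariant_def subspace_0)
  moreover have o: "orthonormal ({} :: 'a set)" by (simp add: orthonormal_def)
  ultimately have leb: "lebesgue_of V = leb {}" and V: "V = {0}" and "dim V = 0"
    using lebesgue_of_eq_leb[OF o] dim_span_orthonormal[OF o] by auto
  then have "p = 0" using empty.prems d_pos by simp
  have "proj (lines e {}) ` V = V" by (simp add: V linear_0[OF linear_proj])
  moreover have "scales_volume (proj (lines e {})) (leb {}) (leb {}) 1"
    by (rule scales_volume_cong[of "\<lambda>x. x"])
      (use o in \<open>auto simp: scales_volume_def space_leb linear_0[OF linear_proj]\<close>)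
  ultimately have "proj_factor e V {} 1"
    by (simp add: proj_factor_def leb V[symmetric]) (simp add: V)
  moreover have "idx ({} :: 'i set) p = {{}}" using \<open>p = 0\<close> by (auto simp: idx_def)
  ultimately show ?case by (intro exI[of _ "\<lambda>_. 1"]) simp
next
  case (insert j J)
  let ?H = "span (lines e J)" and ?J = "insert j J"
  note fr = insert.prems(1)
  have frJ: "frame e J" using frame_subset[OF fr] by blast
  have fr_ins: "frame e (insert j L)" "frame e L" "j \<notin> L" if "L \<subseteq> J" for L
    using frame_subset[OF fr] that insert.hyps by blast+
  have ej: "norm (e j) = 1" using fr by (simp add: frame_def)
  have subV: "subspace V" and actV: "\<And>k x. k \<in> K \<Longrightarrow> x \<in> V \<Longrightarrow> act k x \<in> V"
    using insert.prems(2) by (auto simp: invariant_def)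
  let ?Pj = "proj (orbit (e j))"
  have Pj_H: "?Pj x = 0" if "x \<in> ?H" for x
    by (rule proj_zero) (use lines_orth[OF fr insert.hyps(2) that] in \<open>auto intro: span_base\<close>)
  have split: "proj (lines e (insert j L)) x = proj (lines e L) x + ?Pj x" if "L \<subseteq> J" for L x
    by (rule proj_lines_insert[OF fr_ins(1,3)[OF that]])
  have V_eq: "x = proj (lines e J) x + ?Pj x" if "x \<in> V" for x
    using split[of J x] proj_id[OF frame_lines(1)[OF fr], of x] insert.prems(3) that by auto
  obtain BV where BV: "orthonormal BV" "span BV = V"
    using orthonormal_basis_exists[OF orthonormal_finite[OF frame_lines(1)[OF fr]] subV insert.prems(3)] .
  have card_BV: "card BV = d * p" using dim_span_orthonormal[OF BV(1)] BV(2) insert.prems(4) by simp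
  show ?case
  proof (cases "V \<subseteq> ?H")
    case True
    obtain s where s: "\<forall>I\<in>idx J p. proj_factor e V I (s I)" "(\<Sum>I\<in>idx J p. (s I)\<^sup>2) = 1"
      using insert.IH[OF frJ insert.prems(2) True insert.prems(4)] by blast
    show ?thesis
    proof (cases p)
      case 0
      then show ?thesis using s idx_insert_0[OF insert.hyps(1), of j] by auto
    next
      case (Suc p')
      define s' where "s' I = (if j \<in> I then 0 else s I)" for I
      have s'_insert: "s' (insert j L) = 0" for L by (simp add: s'_def)
      \<comment> \<open>A projection of a subspace of \<open>?H\<close> on a coordinate subspace that uses the line \<open>j\<close> has too small an image.\<close>
      have "proj_factor e V (insert j L) 0" if "L \<in> idx J p'" for L
      proof -
        have L: "L \<subseteq> J" "card L = p'" using that by (auto simp: idx_def)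
        have "proj (lines e (insert j L)) ` V \<subseteq> span (lines e L)"
          using True Pj_H by (auto simp: split[OF L(1)] proj_in_span)
        then have "\<not> inj_on (proj (lines e (insert j L))) V"
          using d_pos by (intro not_inj_if_dim_less[OF fr_ins(2)[OF L(1)] BV]) (simp_all add: card_BV L Suc)
        then show ?thesis by (simp add: proj_factor_def)
      qed
      moreover have "proj_factor e V I (s' I)" if "I \<in> idx J p" for I
        using s(1) that insert.hyps(2) by (auto simp: idx_def s'_def)
      moreover have "(\<Sum>I\<in>idx ?J p. (s' I)\<^sup>2) = (\<Sum>I\<in>idx J p. (s I)\<^sup>2)"
      proof -
        have "(\<Sum>I\<in>idx J p. (s' I)\<^sup>2) = (\<Sum>I\<in>idx J p. (s I)\<^sup>2)"
          using insert.hyps(2) by (intro sum.cong) (auto simp: s'_def idx_def)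
        then show ?thesis
          by (simp add: Suc sum_idx_insert_Suc[OF insert.hyps]) (simp add: s'_def)
      qed
      ultimately show ?thesis
        using s(2) s'_insert
        by (intro exI[of _ s']) (auto simp: Suc idx_insert_Suc[OF insert.hyps])
    qed
  next
    case False
    \<comment> \<open>Here \<open>V\<close> is the orthogonal sum of \<open>V'\<close> and of the line of the unit vector \<open>u = h + q\<close>.\<close>
    define V' where "V' = V \<inter> ?H"
    have invV': "invariant V'"
      using insert.prems(2) invariant_lines[of e J] by (auto simp: V'_def invariant_def subspace_inter)
    then have subV': "subspace V'" by (simp add: invariant_def)
    obtain B' where B': "orthonormal B'" "span B' = V'"
      using orthonormal_basis_exists[OF orthonormal_finite[OF frame_lines(1)[OF frJ]] subV'] V'_def by blast
    obtain x where x: "x \<in> V" "x \<notin> ?H" using False by blast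
    define u0 where "u0 = x - proj B' x"
    have projV': "proj B' x \<in> V'" using proj_in_span[of B' x] B'(2) by simp
    have "u0 \<in> V" using x(1) projV' subspace_diff[OF subV] by (auto simp: u0_def V'_def)
    have "u0 \<noteq> 0" using x(2) projV' by (auto simp: u0_def V'_def)
    define u where "u = u0 /\<^sub>R norm u0"
    have u: "u \<in> V" "norm u = 1"
      using \<open>u0 \<in> V\<close> \<open>u0 \<noteq> 0\<close> subspace_scale[OF subV] by (auto simp: u_def)
    have u_V': "inner u y = 0" if "y \<in> V'" for y
      using proj_residual[OF B'(1), of y x] that B'(2) by (simp add: u_def u0_def)
    define h q where "h = proj (lines e J) u" and "q = ?Pj u"
    have uhq: "u = h + q" using V_eq[OF u(1)] by (simp add: h_def q_def)
    have h_H: "h \<in> ?H" and q_j: "q \<in> span (orbit (e j))"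
      by (simp_all add: h_def q_def proj_in_span)
    have hq: "inner h q = 0" by (rule lines_orth[OF fr insert.hyps(2) h_H q_j])
    have "(norm u)\<^sup>2 = (norm h)\<^sup>2 + (norm q)\<^sup>2"
      using hq by (simp add: uhq power2_norm_eq_inner inner_add_left inner_add_right inner_commute[of q h])
    then have cs: "(norm h)\<^sup>2 + (norm q)\<^sup>2 = 1" using u(2) by simp
    have "q \<noteq> 0"
    proof
      assume "q = 0"
      then have "u \<in> V'" using uhq h_H u(1) by (simp add: V'_def)
      from u_V'[OF this] u(2) show False by auto
    qed
    define s w where "s = norm q" and "w = q /\<^sub>R s"
    have s: "0 < s" and w: "norm w = 1" and q_eq: "q = s *\<^sub>R w"
      using \<open>q \<noteq> 0\<close> by (simp_all add: s_def w_def)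
    have Pj_act: "?Pj (act k y) = act k (?Pj y)" if "k \<in> K" for k y
      using proj_lines_act[of e "{j}" k y] frame_subset[OF fr, of "{j}"] that by (simp add: lines_singleton)
    have inv_j: "invariant (span (orbit (e j)))"
      using invariant_lines[of e "{j}"] by (simp add: lines_singleton)
    have w_j: "w \<in> span (orbit (e j))" using q_j by (simp add: w_def span_scale)
    have "span (orbit w) \<subseteq> span (orbit (e j))"
      using orbit_subset[OF inv_j w_j] by (simp add: span_minimal)
    then have span_w: "span (orbit w) = span (orbit (e j))"
      using dim_span_orthonormal[OF orthonormal_orbit[OF w]] card_orbit w ej
      by (intro subspace_eq_if_dim_eq[OF orthonormal_orbit[OF ej]]) auto
    have uB': "inner b a = 0" if "b \<in> B'" "a \<in> orbit u" for a b
    proof -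
      obtain k where k: "k \<in> K" "a = act k u" using \<open>a \<in> orbit u\<close> by (auto simp: orbit_def)
      have "b \<in> V'" using \<open>b \<in> B'\<close> B'(2) span_base by blast
      then have "inner (act k u) b = 0"
        using invV' u_V' by (intro act_perp1[OF _ k(1)]) (auto simp: invariant_def)
      then show ?thesis by (simp add: k inner_commute)
    qed
    note Bu = orthonormal_Un[OF B'(1) orthonormal_orbit[OF u(2)] uB']
    have V_span: "V = span (B' \<union> orbit u)"
    proof
      have "B' \<subseteq> V" using B'(2) span_superset[of B'] by (auto simp: V'_def)
      then show "span (B' \<union> orbit u) \<subseteq> V"
        using orbit_subset[OF insert.prems(2) u(1)] subV by (intro span_minimal) auto
      show "V \<subseteq> span (B' \<union> orbit u)"
      proof
        fix y assume y: "y \<in> V"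
        have "?Pj ` orbit u = orbit q"
          using Pj_act by (auto simp: orbit_def q_def image_image)
        then have "?Pj ` span (orbit u) = span (orbit q)"
          using linear_span_image[OF linear_proj, of "orbit (e j)" "orbit u"] by simp
        also have "\<dots> = span (orbit (e j))"
          using span_orbit_scale[of s w] s by (simp add: q_eq span_w)
        finally have "?Pj y \<in> ?Pj ` span (orbit u)" by (simp add: proj_in_span)
        then obtain z where z: "z \<in> span (orbit u)" "?Pj y = ?Pj z" by blast
        have "z \<in> V"
          using z(1) span_minimal[OF orbit_subset[OF insert.prems(2) u(1)] subV] by blast
        then have yz: "y - z \<in> V" using y subspace_diff[OF subV] by blast
        have "?Pj (y - z) = 0" by (simp add: linear_diff[OF linear_proj] z(2))
        then have "y - z = proj (lines e J) (y - z)" using V_eq[OF yz] by simp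
        then have "y - z \<in> ?H" by (metis proj_in_span)
        with yz have "y - z \<in> span B'" by (simp add: B'(2) V'_def)
        then have "y - z \<in> span (B' \<union> orbit u)" using span_mono[of B' "B' \<union> orbit u"] by blast
        moreover have "z \<in> span (B' \<union> orbit u)"
          using z(1) span_mono[of "orbit u" "B' \<union> orbit u"] by blast
        ultimately have "(y - z) + z \<in> span (B' \<union> orbit u)" by (rule span_add)
        then show "y \<in> span (B' \<union> orbit u)" by simp
      qed
    qed
    have leb_V: "lebesgue_of V = leb (B' \<union> orbit u)"
      unfolding V_span by (rule lebesgue_of_eq_leb[OF Bu(1)])
    have leb_V': "lebesgue_of V' = leb B'"
      using lebesgue_of_eq_leb[OF B'(1)] B'(2) by simp
    have "card (B' \<union> orbit u) = d * p"
      using dim_span_orthonormal[OF Bu(1)] insert.prems(4) V_span by simp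
    then have card_sum: "card B' + d = d * p"
      using card_Un_disjoint[OF _ _ Bu(2)] Bu(1) B'(1) orthonormal_orbit[OF u(2)] card_orbit[OF u(2)]
      by (simp add: orthonormal_finite)
    then obtain p' where p: "p = Suc p'" using d_pos by (cases p) auto
    have card_B': "card B' = d * p'" using card_sum p by simp
    have dimV': "dim V' = d * p'"
      using dim_span_orthonormal[OF B'(1)] B'(2) card_B' by simp
    have V'_H: "V' \<subseteq> ?H" by (simp add: V'_def)
    obtain s1 where s1: "\<And>L. L \<in> idx J p' \<Longrightarrow> proj_factor e V' L (s1 L)" "(\<Sum>L\<in>idx J p'. (s1 L)\<^sup>2) = 1"
      using insert.IH[OF frJ invV' V'_H dimV'] by blast
    have inj_u: "inj_on (\<lambda>k. act k u) K" "(\<lambda>k. act k u) ` K = orbit u"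
      using inj_act[OF u(2)] by (auto simp: orbit_def)
    \<comment> \<open>Multi-indices containing \<open>j\<close>: on \<open>V'\<close> only the indices in \<open>L\<close> matter, and \<open>u\<close> adds the factor \<open>s\<close>.\<close>
    have fac_j: "proj_factor e V (insert j L) (s * s1 L)" if "L \<in> idx J p'" for L
    proof -
      have L: "L \<subseteq> J" "card L = p'" using that by (auto simp: idx_def)
      let ?T = "proj (lines e (insert j L))" and ?PL = "proj (lines e L)"
      have T_V': "?T y = ?PL y" if "y \<in> V'" for y
        using split[OF L(1), of y] Pj_H V'_H that by auto
      show ?thesis
      proof (cases "inj_on ?PL V'")
        case False
        then have "\<not> inj_on ?T V'" using inj_on_cong[of V' ?T ?PL] T_V' by blast
        then have "\<not> inj_on ?T V" using inj_on_subset[of ?T V V'] by (auto simp: V'_def)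
        moreover have "s1 L = 0" using s1(1)[OF that] False by (simp add: proj_factor_def)
        ultimately show ?thesis by (simp add: proj_factor_def)
      next
        case True
        note oL = frame_lines[OF fr_ins(2)[OF L(1)]]
        have "dim (?PL ` span B') = card (lines e L)"
          using dim_inj_image[OF B'(1) linear_proj, of "lines e L"] True B'(2) card_B' oL(2) L(2) by simp
        then have PL_image: "?PL ` V' = span (lines e L)"
          unfolding B'(2)[symmetric]
          by (intro subspace_eq_if_dim_eq[OF oL(1)])
            (auto simp: proj_in_span intro!: linear_subspace_image linear_proj)
        then have T_image: "?T ` span B' = span (lines e L)"
          using T_V' by (simp add: B'(2))
        have T_inj: "inj_on ?T (span B')"
          using True T_V' inj_on_cong[of V' ?T ?PL] B'(2) by blast
        have s1_nn: "0 \<le> s1 L" and "scales_volume ?PL (leb B') (leb (lines e L)) (s1 L ^ d)"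
          using s1(1)[OF that] True PL_image leb_V' lebesgue_of_eq_leb[OF oL(1)]
          by (auto simp: proj_factor_def)
        then have sc: "scales_volume ?T (leb B') (leb (lines e L)) (s1 L ^ d)"
          by (rule_tac scales_volume_cong[of ?PL]) (use B' T_V' in \<open>auto simp: space_leb\<close>)
        have wL: "inner a b = 0" if "a \<in> lines e L" "b \<in> orbit w" for a b
          using that span_w span_base
          by (intro lines_orth[OF fr_ins(1,3)[OF L(1)]]) auto
        note Lw = orthonormal_Un[OF oL(1) orthonormal_orbit[OF w] wL]
        have Tu: "?T (act k u) - s *\<^sub>R act k w \<in> span (lines e L)" if "k \<in> K" for k
        proof -
          have "?T (act k u) = act k (?PL u) + act k q"
            using proj_lines_act[OF fr_ins(1)[OF L(1)] that]
            by (simp add: split[OF L(1)] linear_add[OF act_linear[OF that]] q_def)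
          then have "?T (act k u) - s *\<^sub>R act k w = act k (?PL u)"
            by (simp add: q_eq linear_scale[OF act_linear[OF that]])
          then show ?thesis
            using invariant_lines[of e L] that by (simp add: invariant_def proj_in_span)
        qed
        have w_im: "(\<lambda>k. act k w) ` K = orbit w" by (simp add: orbit_def)
        have ext: "?T ` span (B' \<union> orbit u) = span (lines e L \<union> orbit w) \<and> inj_on ?T (span (B' \<union> orbit u)) \<and>
            scales_volume ?T (leb (B' \<union> orbit u)) (leb (lines e L \<union> orbit w)) (s ^ card K * s1 L ^ d)"
          using scales_leb_extend[OF finite_K, of B' "\<lambda>k. act k u" "lines e L" "\<lambda>k. act k w" ?T s "s1 L ^ d"]
            Bu Lw inj_u inj_act[OF w] linear_proj[of "lines e (insert j L)"] T_inj T_image Tu s sc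
          by (simp add: w_im Int_commute)
        then show ?thesis
          using s s1_nn lebesgue_of_eq_leb[OF Lw(1)] leb_V
          by (simp add: proj_factor_def V_span[symmetric] d_def[symmetric] power_mult_distrib)
      qed
    qed
    \<comment> \<open>Multi-indices avoiding \<open>j\<close>: the projection factors through \<open>?H\<close>, where \<open>V\<close> becomes \<open>?W\<close> if \<open>h \<noteq> 0\<close>.\<close>
    have "\<exists>r. (\<forall>I\<in>idx J p. proj_factor e V I (r I)) \<and> (\<Sum>I\<in>idx J p. (r I)\<^sup>2) = (norm h)\<^sup>2"
    proof (cases "h = 0")
      case True
      have "proj_factor e V I 0" if "I \<in> idx J p" for I
      proof (rule proj_factor_not_inj[OF u(1)])
        have "proj (lines e I) h = proj (lines e I) u"
          using that unfolding h_def by (intro proj_lines_proj[OF frJ]) (simp add: idx_def)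
        then show "proj (lines e I) u = 0" by (simp add: True linear_0[OF linear_proj])
      qed (use u subspace_0[OF subV] in auto)
      then show ?thesis by (intro exI[of _ "\<lambda>_. 0"]) (simp add: True)
    next
      case False
      define c g where "c = norm h" and "g = h /\<^sub>R c"
      have c: "0 < c" and g: "norm g = 1" and h_eq: "h = c *\<^sub>R g"
        using False by (simp_all add: c_def g_def)
      have g_V': "inner g y = 0" if "y \<in> V'" for y
      proof -
        have "inner q y = 0"
          using lines_orth[OF fr insert.hyps(2) _ q_j] V'_H that by (metis inner_commute subsetD)
        then have "inner h y = 0" using u_V'[OF that] by (simp add: uhq inner_add_left)
        then show ?thesis by (simp add: g_def)
      qed
      have gB': "inner b a = 0" if "b \<in> B'" "a \<in> orbit g" for a b
      proof -
        obtain k where k: "k \<in> K" "a = act k g" using \<open>a \<in> orbit g\<close> by (auto simp: orbit_def)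
        have "b \<in> V'" using \<open>b \<in> B'\<close> B'(2) span_base by blast
        then have "inner (act k g) b = 0"
          using invV' g_V' by (intro act_perp1[OF _ k(1)]) (auto simp: invariant_def)
        then show ?thesis by (simp add: k inner_commute)
      qed
      note Bg = orthonormal_Un[OF B'(1) orthonormal_orbit[OF g] gB']
      let ?W = "span (B' \<union> orbit g)"
      have leb_W: "lebesgue_of ?W = leb (B' \<union> orbit g)"
        by (rule lebesgue_of_eq_leb[OF Bg(1)])
      have invW: "invariant ?W"
      proof (rule invariant_span)
        fix y k assume y: "y \<in> B' \<union> orbit g" and k: "k \<in> K"
        show "act k y \<in> ?W"
        proof (cases "y \<in> B'")
          case True
          then have "act k y \<in> span B'"
            using invV' k B'(2) span_base[of y B'] by (auto simp: invariant_def)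
          then show ?thesis using span_mono[of B' "B' \<union> orbit g"] by blast
        next
          case False
          then have "act k y \<in> span (orbit g)" using y k act_orbit by blast
          then show ?thesis using span_mono[of "orbit g" "B' \<union> orbit g"] by blast
        qed
      qed
      have W_H: "?W \<subseteq> ?H"
      proof (rule span_minimal)
        have "g \<in> ?H" using h_H by (simp add: g_def span_scale)
        then show "B' \<union> orbit g \<subseteq> ?H"
          using orbit_subset[OF invariant_lines, of g e J] V'_H B'(2) span_superset[of B'] by auto
      qed simp
      have "card (B' \<union> orbit g) = d * p"
        using card_Un_disjoint[OF _ _ Bg(2)] B'(1) orthonormal_orbit[OF g] card_orbit[OF g] card_sum
        by (simp add: orthonormal_finite)
      then have dimW: "dim ?W = d * p" using dim_span_orthonormal[OF Bg(1)] by simp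
      obtain s2 where s2: "\<And>I. I \<in> idx J p \<Longrightarrow> proj_factor e ?W I (s2 I)" "(\<Sum>I\<in>idx J p. (s2 I)\<^sup>2) = 1"
        using insert.IH[OF frJ invW W_H dimW] by blast
      let ?Q = "proj (lines e J)"
      have Q_V': "?Q y = y" if "y \<in> span B'" for y
        using that V'_H B'(2) by (intro proj_id[OF frame_lines(1)[OF frJ]]) auto
      have Qu: "?Q (act k u) - c *\<^sub>R act k g \<in> span B'" if "k \<in> K" for k
      proof -
        have "?Q (act k u) = act k h"
          using proj_lines_act[OF frJ that] by (simp add: h_def)
        then show ?thesis
          by (simp add: h_eq linear_scale[OF act_linear[OF that]] span_zero)
      qed
      have g_im: "(\<lambda>k. act k g) ` K = orbit g" by (simp add: orbit_def)
      have Q1: "scales_volume ?Q (leb B') (leb B') 1"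
        by (rule scales_volume_cong[of "\<lambda>x. x"]) (use B' Q_V' in \<open>auto simp: scales_volume_def space_leb\<close>)
      have Q2: "inj_on ?Q (span B')" "?Q ` span B' = span B'"
        using Q_V' by (auto simp: inj_on_def image_iff)
      have Q: "?Q ` span (B' \<union> orbit u) = ?W \<and> inj_on ?Q (span (B' \<union> orbit u)) \<and>
            scales_volume ?Q (leb (B' \<union> orbit u)) (leb (B' \<union> orbit g)) (c ^ card K * 1)"
        using scales_leb_extend[OF finite_K, of B' "\<lambda>k. act k u" B' "\<lambda>k. act k g" ?Q c 1]
            Bu Bg inj_u inj_act[OF g] linear_proj[of "lines e J"] Q1 Q2 Qu c
        by (simp add: g_im Int_commute)
      then have QV: "?Q ` V = ?W" "inj_on ?Q V" "scales_volume ?Q (lebesgue_of V) (lebesgue_of ?W) (c ^ d)"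
        using V_span leb_V leb_W by (simp_all add: d_def)
      have "proj_factor e V I (c * s2 I)" if "I \<in> idx J p" for I
      proof -
        let ?P = "proj (lines e I)"
        have PQ: "?P (?Q y) = ?P y" for y
          using that by (intro proj_lines_proj[OF frJ]) (simp add: idx_def)
        have im: "?P ` ?W = ?P ` V" unfolding QV(1)[symmetric] by (simp add: image_image PQ)
        have "inj_on ?P V \<longleftrightarrow> inj_on (?P \<circ> ?Q) V" by (simp add: PQ comp_def)
        also have "\<dots> \<longleftrightarrow> inj_on ?P ?W"
          unfolding QV(1)[symmetric] using comp_inj_on_iff[OF QV(2)] by blast
        finally have inj: "inj_on ?P V \<longleftrightarrow> inj_on ?P ?W" .
        show ?thesis
        proof (cases "inj_on ?P ?W")
          case True
          then have "scales_volume ?P (lebesgue_of ?W) (lebesgue_of (?P ` V)) (s2 I ^ d)" "0 \<le> s2 I"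
            using s2(1)[OF that] by (simp_all add: proj_factor_def im)
          then show ?thesis
            using scales_volume_compose[OF QV(3)] c True inj
            by (fastforce simp: proj_factor_def PQ power_mult_distrib mult.commute)
        next
          case False
          then show ?thesis using s2(1)[OF that] inj by (simp add: proj_factor_def)
        qed
      qed
      moreover have "(\<Sum>I\<in>idx J p. (c * s2 I)\<^sup>2) = (norm h)\<^sup>2"
        using s2(2) by (simp add: power_mult_distrib sum_distrib_left[symmetric] c_def)
      ultimately show ?thesis by (intro exI[of _ "\<lambda>I. c * s2 I"]) auto
    qed
    then obtain r where r: "\<And>I. I \<in> idx J p \<Longrightarrow> proj_factor e V I (r I)" "(\<Sum>I\<in>idx J p. (r I)\<^sup>2) = (norm h)\<^sup>2"
      by blast
    define t where "t I = (if j \<in> I then s * s1 (I - {j}) else r I)" for I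
    have t1: "t I = r I" if "I \<in> idx J p" for I
      using that insert.hyps(2) by (auto simp: t_def idx_def)
    have t2: "t (insert j L) = s * s1 L" if "L \<in> idx J p'" for L
    proof -
      have "insert j L - {j} = L" using that insert.hyps(2) by (auto simp: idx_def)
      then show ?thesis by (simp add: t_def)
    qed
    have "(\<Sum>I\<in>idx ?J p. (t I)\<^sup>2) = (\<Sum>I\<in>idx J p. (r I)\<^sup>2) + (\<Sum>L\<in>idx J p'. (s * s1 L)\<^sup>2)"
      unfolding p sum_idx_insert_Suc[OF insert.hyps] by (simp add: t1 t2 p[symmetric] cong: sum.cong)
    also have "\<dots> = 1"
      using cs by (simp add: r(2) power_mult_distrib sum_distrib_left[symmetric] s1(2) s_def)
    finally have "(\<Sum>I\<in>idx ?J p. (t I)\<^sup>2) = 1" .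
    moreover have "\<forall>I\<in>idx ?J p. proj_factor e V I (t I)"
      unfolding p idx_insert_Suc[OF insert.hyps]
      using r(1) fac_j t1 t2 by (auto simp: p)
    ultimately show ?thesis by blast
  qed
qed

end

lemma orth_proj_inner_span:
  assumes "orthonormal B"
  shows "orth_proj inner (span B) = proj B"
proof
  fix x
  show "orth_proj inner (span B) x = proj B x"
    unfolding orth_proj_def
  proof (rule the_equality)
    show "proj B x \<in> span B \<and> (\<forall>w\<in>span B. inner (x - proj B x) w = 0)"
      using proj_in_span proj_residual[OF assms] by blast
    show "y = proj B x" if "y \<in> span B \<and> (\<forall>w\<in>span B. inner (x - y) w = 0)" for y
      using that proj_unique[OF assms, of y x] by (simp add: span_base)
  qed
qed

context line_structure
begin

text \<open>
  A projection that is not injective on \<open>V\<close> has an image of smaller dimension, to which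
  \<^const>\<open>measure_of_dim\<close> assigns \<open>0\<close>.
\<close>
lemma measure_proj_factor:
  assumes V: "subspace V" "V \<subseteq> span (lines e J)" "frame e J" and S: "S \<in> sets (lebesgue_of V)"
    and f: "proj_factor e V I s" and m: "m = dim V"
  shows "measure_of_dim m (proj (lines e I) ` V) (proj (lines e I) ` S) =
    ennreal (s ^ d) * measure_of_dim m V S"
proof -
  obtain B where B: "orthonormal B" "span B = V"
    using orthonormal_basis_exists[OF orthonormal_finite[OF frame_lines(1)[OF V(3)]] V(1,2)] .
  let ?P = "proj (lines e I)"
  show ?thesis
  proof (cases "inj_on ?P V")
    case True
    then have "dim (?P ` V) = dim V"
      using dim_inj_image[OF B(1) linear_proj, of "lines e I"] dim_span_orthonormal[OF B(1)] B(2) by simp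
    then show ?thesis
      using f True S m by (simp add: proj_factor_def measure_of_dim_def scales_volume_def)
  next
    case False
    then have "dim (?P ` V) \<noteq> dim V"
      using inj_on_if_dim_eq[OF B(1) linear_proj, of "lines e I"] dim_span_orthonormal[OF B(1)] B(2) by auto
    then show ?thesis
      using f False m d_pos by (simp add: proj_factor_def measure_of_dim_def power_0_left)
  qed
qed

end


section \<open>The real case\<close>

lemma real_line_structure: "line_structure {()} (\<lambda>_ x. x :: 'a::real_inner)"
  by unfold_locales (auto simp: linear_iff intro: span_base)

interpretation real_lines: line_structure "{()}" "\<lambda>_ x. x :: 'a::real_inner"
  by (rule real_line_structure)

lemma real_lines_lines: "real_lines.lines e I = e ` I"
  by (auto simp: real_lines.lines_def real_lines.orbit_def)

lemma span_normalize:
  assumes "\<And>i. i \<in> I \<Longrightarrow> v i \<noteq> 0"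
  shows "span ((\<lambda>i. v i /\<^sub>R norm (v i)) ` I) = span (v ` I)"
proof (intro equalityI span_minimal subspace_span subsetI)
  fix x assume "x \<in> (\<lambda>i. v i /\<^sub>R norm (v i)) ` I"
  then show "x \<in> span (v ` I)" by (auto intro: span_scale span_base)
next
  fix x assume "x \<in> v ` I"
  then obtain i where i: "i \<in> I" "x = v i" by blast
  then have "norm (v i) *\<^sub>R (v i /\<^sub>R norm (v i)) \<in> span ((\<lambda>i. v i /\<^sub>R norm (v i)) ` I)"
    by (intro span_scale span_base) auto
  then show "x \<in> span ((\<lambda>i. v i /\<^sub>R norm (v i)) ` I)" using assms i by simp
qed

proposition real_pythagoras:
  fixes V :: "'a::real_inner set"
  assumes V: "subspace V" and S: "S \<in> sets (lebesgue_of V)" and v: "orthogonal_basis v"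
  shows "(measure_of_dim (dim V) V S)\<^sup>2 =
    (\<Sum>I\<in>multi_indices (dim (UNIV :: 'a set)) (dim V).
      let P = orth_proj inner (coord_subspace v I) in (measure_of_dim (dim V) (P ` V) (P ` S))\<^sup>2)"
proof -
  let ?J = "{1..dim (UNIV :: 'a set)}"
  let ?m = "measure_of_dim (dim V) V S"
  define e where "e i = v i /\<^sub>R norm (v i)" for i
  have v0: "v i \<noteq> 0" if "i \<in> ?J" for i
    using v that dependent_zero[of "v ` ?J"] by (force simp: orthogonal_basis_def Let_def)
  have fr: "real_lines.frame e ?J"
    using v v0 by (simp add: real_lines.frame_def e_def orthogonal_basis_def Let_def)
  have span_e: "span (real_lines.lines e I) = span (v ` I)" if "I \<subseteq> ?J" for I
    unfolding real_lines_lines e_def using v0 that by (intro span_normalize) blast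
  have VJ: "V \<subseteq> span (real_lines.lines e ?J)"
    using v by (simp add: span_e orthogonal_basis_def Let_def)
  have inv: "real_lines.invariant V" using V by (simp add: real_lines.invariant_def)
  have d: "real_lines.d = 1" by (simp add: real_lines.d_def)
  have idx: "multi_indices (dim (UNIV :: 'a set)) (dim V) = idx ?J (dim V)"
    by (simp add: multi_indices_def idx_def)
  have "\<exists>s. (\<forall>I\<in>idx ?J (dim V). real_lines.proj_factor e V I (s I)) \<and>
      (\<Sum>I\<in>idx ?J (dim V). (s I)\<^sup>2) = 1"
    by (rule real_lines.sum_proj_factor[OF _ fr inv VJ]) (simp_all add: d)
  then obtain s where s: "\<And>I. I \<in> idx ?J (dim V) \<Longrightarrow> real_lines.proj_factor e V I (s I)"
    "(\<Sum>I\<in>idx ?J (dim V). (s I)\<^sup>2) = 1" by blast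
  have summand: "(let P = orth_proj inner (coord_subspace v I) in (measure_of_dim (dim V) (P ` V) (P ` S))\<^sup>2)
      = ennreal ((s I)\<^sup>2) * ?m\<^sup>2" if I: "I \<in> idx ?J (dim V)" for I
  proof -
    have IJ: "I \<subseteq> ?J" using I by (simp add: idx_def)
    have "orth_proj inner (coord_subspace v I) = proj (real_lines.lines e I)"
      unfolding coord_subspace_def span_e[OF IJ, symmetric]
      by (intro orth_proj_inner_span real_lines.frame_lines(1)[OF real_lines.frame_subset[OF fr IJ]])
    moreover have "0 \<le> s I" using s(1)[OF I] by (simp add: real_lines.proj_factor_def)
    ultimately show ?thesis
      using real_lines.measure_proj_factor[OF V VJ fr S s(1)[OF I] refl]
      by (simp add: d power_mult_distrib ennreal_power)
  qed
  have "(\<Sum>I\<in>idx ?J (dim V). ennreal ((s I)\<^sup>2) * ?m\<^sup>2) = ?m\<^sup>2"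
    by (simp add: sum_distrib_right[symmetric] sum_ennreal s(2) del: One_nat_def)
  then show ?thesis unfolding idx by (simp add: summand cong: sum.cong)
qed


section \<open>The complex case\<close>

lemma scaleC_scaleR: "scaleC a (r *\<^sub>R x) = r *\<^sub>R scaleC a (x :: 'a::complex_inner)"
  by (simp add: scaleC_of_real[symmetric] scaleC_scaleC mult.commute)

lemma scaleC_one: "scaleC 1 x = (x :: 'a::complex_inner)"
  using scaleC_of_real[of 1 x] by simp

lemma linear_scaleC: "linear (scaleC a :: 'a::complex_inner \<Rightarrow> 'a)"
  by (rule linearI) (simp_all add: scaleC_add_right scaleC_scaleR)

lemma scaleC_i_i: "scaleC \<i> (scaleC \<i> x) = - (x :: 'a::complex_inner)"
  using scaleC_of_real[of "-1" x] by (simp add: scaleC_scaleC)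

lemma scaleC_eq: "scaleC c x = Re c *\<^sub>R x + Im c *\<^sub>R scaleC \<i> (x :: 'a::complex_inner)"
proof -
  have "scaleC c x = scaleC (complex_of_real (Re c) + complex_of_real (Im c) * \<i>) x"
    by (simp add: complex_eq mult.commute)
  also have "\<dots> = Re c *\<^sub>R x + Im c *\<^sub>R scaleC \<i> x"
    by (simp only: scaleC_add_left scaleC_scaleC[symmetric] scaleC_of_real)
  finally show ?thesis .
qed

lemma cinner_scaleC_right: "cinner x (scaleC a y) = a * cinner x (y :: 'a::complex_inner)"
proof -
  have "cinner x (scaleC a y) = cnj (cinner (scaleC a y) x)" by (rule cinner_commute)
  also have "\<dots> = a * cnj (cinner y x)" by (simp add: cinner_scaleC_left)
  also have "cnj (cinner y x) = cinner x y" by (rule cinner_commute[symmetric])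
  finally show ?thesis .
qed

lemma inner_scaleC_i: "inner (scaleC \<i> x) (scaleC \<i> y) = inner x (y :: 'a::complex_inner)"
  by (simp add: inner_eq_Re_cinner cinner_scaleC_left cinner_scaleC_right)

lemma inner_scaleC_i_right: "inner x (scaleC \<i> y) = - Im (cinner x (y :: 'a::complex_inner))"
  by (simp add: inner_eq_Re_cinner cinner_scaleC_right)

lemma inner_scaleC_i_left: "inner (scaleC \<i> x) y = - inner x (scaleC \<i> (y :: 'a::complex_inner))"
  using inner_scaleC_i[of "scaleC \<i> x" y] by (simp add: scaleC_i_i inner_minus_left)

lemma inner_scaleC_i_self: "inner x (scaleC \<i> x) = (0::real)" for x :: "'a::complex_inner"
  using inner_scaleC_i_left[of x x] by (simp add: inner_commute)

text \<open>The real basis \<open>{1, \<i>}\<close> of the complex numbers, acting by scalar multiplication.\<close>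
definition cact :: "bool \<Rightarrow> 'a::complex_inner \<Rightarrow> 'a" where
  "cact b x = (if b then scaleC \<i> x else x)"

interpretation complex_lines: line_structure "UNIV :: bool set" "cact :: bool \<Rightarrow> 'a::complex_inner \<Rightarrow> 'a"
proof (rule line_structure.intro)
  show "\<exists>k\<in>UNIV. \<forall>x::'a. cact k x = x" by (intro bexI[of _ False]) (auto simp: cact_def)
  show "linear (cact k :: 'a \<Rightarrow> 'a)" for k
    by (cases k) (auto simp: cact_def[abs_def] linear_scaleC linear_iff scaleC_add_right scaleC_scaleR)
  show "norm (cact k x) = norm x" for k and x :: 'a
    by (simp add: cact_def norm_eq_sqrt_inner inner_scaleC_i)
  show "inner (cact k x) (cact l x) = 0" if "k \<noteq> l" for k l and x :: 'a
    using that by (auto simp: cact_def inner_scaleC_i_self inner_scaleC_i_left)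
  show "cact k (cact l x) \<in> span (range (\<lambda>m. cact m x))" for k l and x :: 'a
  proof -
    have "x \<in> range (\<lambda>m. cact m x)" "scaleC \<i> x \<in> range (\<lambda>m. cact m x)"
      by (auto simp: cact_def image_iff intro: exI[of _ True] exI[of _ False])
    then show ?thesis
      by (auto simp: cact_def scaleC_i_i intro: span_base span_neg)
  qed
  show "inner (cact k x) (cact m y) = 0" if "\<And>l. l \<in> UNIV \<Longrightarrow> inner x (cact l y) = 0" for x y :: 'a and k m
    using that[of True] that[of False]
    by (auto simp: cact_def inner_scaleC_i inner_scaleC_i_left)
qed simp

lemma csubspace_iff: "csubspace V \<longleftrightarrow> complex_lines.invariant (V :: 'a::complex_inner set)"
proof
  assume "csubspace V"
  then show "complex_lines.invariant V"
    by (auto simp: complex_lines.invariant_def cact_def complex_vector.subspace_def subspace_def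
        simp flip: scaleC_of_real)
next
  assume *: "complex_lines.invariant V"
  then have sub: "subspace V" and "\<forall>k. \<forall>x\<in>V. cact k x \<in> V"
    by (simp_all add: complex_lines.invariant_def)
  then have i: "scaleC \<i> x \<in> V" if "x \<in> V" for x
    using that by (metis cact_def)
  show "csubspace V"
    unfolding complex_vector.subspace_def
  proof (intro conjI ballI allI)
    show "scaleC c x \<in> V" if "x \<in> V" for c x
      unfolding scaleC_eq[of c x] using sub i[OF that] that by (intro subspace_add subspace_scale)
  qed (use sub in \<open>simp_all add: subspace_0 subspace_add\<close>)
qed

lemma orth_proj_cinner:
  assumes "csubspace W"
  shows "orth_proj cinner W = orth_proj inner (W :: 'a::complex_inner set)"
proof -
  have "(\<forall>w\<in>W. cinner z w = 0) \<longleftrightarrow> (\<forall>w\<in>W. inner z w = 0)" for z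
  proof
    assume *: "\<forall>w\<in>W. inner z w = 0"
    show "\<forall>w\<in>W. cinner z w = 0"
    proof
      fix w assume w: "w \<in> W"
      then have "scaleC \<i> w \<in> W" using assms by (simp add: complex_vector.subspace_scale)
      then have "Im (cinner z w) = 0" using * inner_scaleC_i_right[of z w] by simp
      moreover have "Re (cinner z w) = 0" using * w by (simp add: inner_eq_Re_cinner)
      ultimately show "cinner z w = 0" by (simp add: complex_eq_iff)
    qed
  qed (simp add: inner_eq_Re_cinner)
  then show ?thesis by (simp add: orth_proj_def[abs_def])
qed

text \<open>Each complex basis vector \<open>b\<close> contributes the two real basis vectors \<open>b\<close> and \<open>\<i> b\<close>.\<close>
lemma cspan_real_basis:
  fixes B :: "'a::complex_inner set"
  assumes "finite B" "cindependent B"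
  shows "\<exists>D. finite D \<and> independent D \<and> span D = cspan B \<and> card D = 2 * card B"
  using assms
proof (induction B rule: finite_induct)
  case empty
  then show ?case by (intro exI[of _ "{}"]) (simp add: independent_empty)
next
  case (insert b B)
  then have b: "b \<notin> cspan B" "cindependent B"
    by (auto simp: complex_vector.independent_insert)
  then obtain D where D: "finite D" "independent D" "span D = cspan B" "card D = 2 * card B"
    using insert.IH by blast
  let ?ib = "scaleC \<i> b"
  have bD: "b \<notin> span D" using b D by simp
  have ibD: "?ib \<notin> span (insert b D)"
  proof
    assume "?ib \<in> span (insert b D)"
    then obtain t where "?ib - t *\<^sub>R b \<in> cspan B"
      using D(3) by (auto simp: span_breakdown_eq)
    moreover have "?ib - t *\<^sub>R b = scaleC (\<i> - complex_of_real t) b"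
      by (simp add: complex_vector.scale_left_diff_distrib scaleC_of_real)
    ultimately have "scaleC (inverse (\<i> - complex_of_real t)) (scaleC (\<i> - complex_of_real t) b) \<in> cspan B"
      by (metis complex_vector.span_scale)
    moreover have "\<i> - complex_of_real t \<noteq> 0" by (simp add: complex_eq_iff)
    ultimately show False using b(1) by (simp add: scaleC_scaleC scaleC_one)
  qed
  have "independent (insert ?ib (insert b D))"
    using D(2) bD ibD by (simp add: independent_insertI)
  moreover have "card (insert ?ib (insert b D)) = 2 * card (insert b B)"
  proof -
    have "b \<notin> D" "?ib \<notin> insert b D"
      using bD ibD span_base by blast+
    then show ?thesis using insert.hyps D by simp
  qed
  moreover have "span (insert ?ib (insert b D)) = cspan (insert b B)"
  proof (intro equalityI subsetI)
    have "subspace (cspan (insert b B))"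
      using csubspace_iff[of "cspan (insert b B)"] by (simp add: complex_lines.invariant_def)
    moreover have "insert ?ib (insert b D) \<subseteq> cspan (insert b B)"
      using span_superset[of D] D(3) complex_vector.span_mono[of B "insert b B"]
      by (auto intro: complex_vector.span_scale complex_vector.span_base)
    ultimately show "x \<in> cspan (insert b B)" if "x \<in> span (insert ?ib (insert b D))" for x
      using that span_minimal by blast
  next
    fix x assume "x \<in> cspan (insert b B)"
    then obtain c where "x - scaleC c b \<in> span D"
      using D(3) by (auto simp: complex_vector.span_breakdown_eq)
    then have "x - Im c *\<^sub>R ?ib - Re c *\<^sub>R b \<in> span D"
      by (simp add: scaleC_eq[of c b] algebra_simps)
    then show "x \<in> span (insert ?ib (insert b D))"
      by (auto simp: span_breakdown_eq)
  qed
  ultimately show ?case using D(1) by (intro exI[of _ "insert ?ib (insert b D)"]) auto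
qed

lemma dim_eq_cdim:
  fixes V :: "'a::complex_inner set"
  assumes "csubspace V" "finite F" "V \<subseteq> cspan F"
  shows "dim V = 2 * cdim V"
proof -
  obtain A where A: "A \<subseteq> V" "cindependent A" "V \<subseteq> cspan A" "card A = cdim V"
    using complex_vector.basis_exists[of V] by metis
  have "finite A"
    using complex_vector.independent_span_bound[OF assms(2) A(2)] A(1) assms(3) by auto
  then obtain D where D: "finite D" "independent D" "span D = cspan A" "card D = 2 * card A"
    using cspan_real_basis[OF _ A(2)] by blast
  have "cspan A = V"
    using A complex_vector.span_minimal[OF A(1) assms(1)] by blast
  then show ?thesis
    using dim_eq_card_independent[OF D(2)] D A(4) by (metis dim_span)
qed

lemma cspan_lines:
  fixes v :: "nat \<Rightarrow> 'a::complex_inner"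
  assumes "\<And>i. i \<in> I \<Longrightarrow> v i \<noteq> 0"
  shows "span (complex_lines.lines (\<lambda>i. v i /\<^sub>R norm (v i)) I) = cspan (v ` I)" (is "span ?L = _")
proof
  have c: "csubspace (span ?L)"
    unfolding csubspace_iff by (rule complex_lines.invariant_lines)
  have "v i \<in> span ?L" if "i \<in> I" for i
  proof -
    have "v i /\<^sub>R norm (v i) \<in> ?L"
      using complex_lines.self_in_orbit that by (auto simp: complex_lines.lines_def)
    then have "norm (v i) *\<^sub>R (v i /\<^sub>R norm (v i)) \<in> span ?L" by (intro span_scale span_base)
    then show ?thesis using assms[OF that] by simp
  qed
  then show "cspan (v ` I) \<subseteq> span ?L"
    by (intro complex_vector.span_minimal c) auto
  have inv: "complex_lines.invariant (cspan (v ` I))"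
    unfolding csubspace_iff[symmetric] by simp
  then have sub: "subspace (cspan (v ` I))" by (simp add: complex_lines.invariant_def)
  have "complex_lines.orbit (v i /\<^sub>R norm (v i)) \<subseteq> cspan (v ` I)" if "i \<in> I" for i
    using that by (intro complex_lines.orbit_subset[OF inv] subspace_scale[OF sub] complex_vector.span_base) auto
  then show "span ?L \<subseteq> cspan (v ` I)"
    by (intro span_minimal sub) (auto simp: complex_lines.lines_def)
qed

proposition complex_pythagoras:
  fixes V :: "'a::complex_inner set"
  assumes V: "csubspace V" and S: "S \<in> sets (lebesgue_of V)" and v: "corthogonal_basis v"
  shows "measure_of_dim (2 * cdim V) V S =
    (\<Sum>I\<in>multi_indices (cdim (UNIV :: 'a set)) (cdim V).
      let P = orth_proj cinner (ccoord_subspace v I) in measure_of_dim (2 * cdim V) (P ` V) (P ` S))"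
proof -
  let ?J = "{1..cdim (UNIV :: 'a set)}"
  let ?m = "measure_of_dim (2 * cdim V) V S"
  define e where "e i = v i /\<^sub>R norm (v i)" for i
  have ind: "cindependent (v ` ?J)" and sp: "cspan (v ` ?J) = UNIV"
    and orth: "\<And>i j. i \<in> ?J \<Longrightarrow> j \<in> ?J \<Longrightarrow> i \<noteq> j \<Longrightarrow> cinner (v i) (v j) = 0"
    using v by (auto simp: corthogonal_basis_def Let_def)
  have v0: "v i \<noteq> 0" if "i \<in> ?J" for i
    using ind that complex_vector.dependent_zero[of "v ` ?J"] by force
  have fr: "complex_lines.frame e ?J"
    using v0 orth
    by (auto simp: complex_lines.frame_def e_def cact_def inner_scaleC_i_right inner_eq_Re_cinner[of "v _" "v _"] scaleC_scaleR)
  have span_e: "span (complex_lines.lines e I) = cspan (v ` I)" if "I \<subseteq> ?J" for I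
    unfolding e_def using v0 that by (intro cspan_lines) blast
  have VJ: "V \<subseteq> span (complex_lines.lines e ?J)"
    unfolding span_e[OF order_refl] sp by simp
  have inv: "complex_lines.invariant V" using V by (simp add: csubspace_iff)
  then have subV: "subspace V" by (simp add: complex_lines.invariant_def)
  have d: "complex_lines.d = 2" by (simp add: complex_lines.d_def)
  have dimV: "dim V = 2 * cdim V"
  proof (rule dim_eq_cdim[OF V])
    show "V \<subseteq> cspan (v ` ?J)" unfolding sp by simp
  qed simp
  have idx: "multi_indices (cdim (UNIV :: 'a set)) (cdim V) = idx ?J (cdim V)"
    by (simp add: multi_indices_def idx_def)
  have "\<exists>s. (\<forall>I\<in>idx ?J (cdim V). complex_lines.proj_factor e V I (s I)) \<and>
      (\<Sum>I\<in>idx ?J (cdim V). (s I)\<^sup>2) = 1"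
    by (rule complex_lines.sum_proj_factor[OF _ fr inv VJ]) (simp_all add: d dimV)
  then obtain s where s: "\<And>I. I \<in> idx ?J (cdim V) \<Longrightarrow> complex_lines.proj_factor e V I (s I)"
    "(\<Sum>I\<in>idx ?J (cdim V). (s I)\<^sup>2) = 1" by blast
  have summand: "(let P = orth_proj cinner (ccoord_subspace v I) in measure_of_dim (2 * cdim V) (P ` V) (P ` S))
      = ennreal ((s I)\<^sup>2) * ?m" if I: "I \<in> idx ?J (cdim V)" for I
  proof -
    have IJ: "I \<subseteq> ?J" using I by (simp add: idx_def)
    have "orth_proj cinner (ccoord_subspace v I) = orth_proj inner (span (complex_lines.lines e I))"
      unfolding ccoord_subspace_def span_e[OF IJ] by (rule orth_proj_cinner) simp
    also have "\<dots> = proj (complex_lines.lines e I)"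
      by (intro orth_proj_inner_span complex_lines.frame_lines(1)[OF complex_lines.frame_subset[OF fr IJ]])
    finally show ?thesis
      using complex_lines.measure_proj_factor[OF subV VJ fr S s(1)[OF I] dimV[symmetric]]
      by (simp add: d)
  qed
  have "(\<Sum>I\<in>idx ?J (cdim V). ennreal ((s I)\<^sup>2) * ?m) = ?m"
    by (simp add: sum_distrib_right[symmetric] sum_ennreal s(2) del: One_nat_def)
  then show ?thesis unfolding idx by (simp add: summand cong: sum.cong)
qed

section \<open>Pythagorean theorem for measures\<close>

theorem theorem3p6:
  shows
    "(\<forall>(V :: 'a::real_inner set) (S :: 'a set) (v :: nat \<Rightarrow> 'a) (p :: nat).
        (\<exists>B :: 'a set. finite B \<and> span B = UNIV) \<longrightarrow>
        subspace V \<longrightarrow> p = dim V \<longrightarrow>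
        S \<subseteq> V \<longrightarrow> S \<in> sets (lebesgue_of V) \<longrightarrow>
        orthogonal_basis v \<longrightarrow>
        (measure_of_dim p V S)\<^sup>2 =
          (\<Sum>I\<in>multi_indices (dim (UNIV :: 'a set)) p.
             let P = orth_proj inner (coord_subspace v I)
             in (measure_of_dim p (P ` V) (P ` S))\<^sup>2)) \<and>
     (\<forall>(V :: 'b::complex_inner set) (S :: 'b set) (v :: nat \<Rightarrow> 'b) (p :: nat).
        (\<exists>B :: 'b set. finite B \<and> cspan B = UNIV) \<longrightarrow>
        csubspace V \<longrightarrow> p = cdim V \<longrightarrow>
        S \<subseteq> V \<longrightarrow> S \<in> sets (lebesgue_of V) \<longrightarrow>
        corthogonal_basis v \<longrightarrow>
        measure_of_dim (2 * p) V S =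
          (\<Sum>I\<in>multi_indices (cdim (UNIV :: 'b set)) p.
             let P = orth_proj cinner (ccoord_subspace v I)
             in measure_of_dim (2 * p) (P ` V) (P ` S)))"
  using real_pythagoras complex_pythagoras by blast

end
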